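(* Let $W,W'$ be Coxeter groups of finite rank and $\alpha\colon W\to W'$ an isomorphism. Let $\Pi$ be the set of simple roots corresponding to the distinguished generating set of $W$, and let $a\in\Pi$. If $\alpha(r_a)$ is not a reflection in $W'$, then the intersection of all maximal finite subgroups of $W$ containing $r_a$ is a parabolic subgroup of $W$ of order greater than $2$.
   Context: $W$ and $W'$ come with distinguished Coxeter generating sets. The distinguished generators of $W$ are $r_a$ ($a\in\Pi$), so $\Pi$ may be regarded simply as the indexing set of the distinguished generators. A reflection in a Coxeter group is a conjugate of a distinguished generator. A parabolic subgroup of $W$ is a conjugate of a subgroup $W_I=\langle r_b\mid b\in I\rangle$ with $I\subseteq\Pi$. *)

theory Defs
  imports "HOL-Algebra.Generated_Groups" "HOL-Library.Extended_Nat"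
begin

(* The letter (a, True) stands for the generator a, and (a, False) for its formal inverse. *)
type_synonym 'a gword = "('a \<times> bool) list"

definition gwords :: "'a set \<Rightarrow> 'a gword set" where
  "gwords S = lists (S \<times> UNIV)"

primrec eval_gword :: "('g, 'x) monoid_scheme \<Rightarrow> ('a \<Rightarrow> 'g) \<Rightarrow> 'a gword \<Rightarrow> 'g" where
  "eval_gword G r [] = \<one>\<^bsub>G\<^esub>"
| "eval_gword G r (l # w) =
     (if snd l then r (fst l) else inv\<^bsub>G\<^esub> (r (fst l))) \<otimes>\<^bsub>G\<^esub> eval_gword G r w"

(* The classes of this relation on gwords S are the elements of the group with
   generators S and relations w = 1 for w in R. *)
inductive pres_eq :: "'a set \<Rightarrow> 'a gword set \<Rightarrow> 'a gword \<Rightarrow> 'a gword \<Rightarrow> bool"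
  for S :: "'a set" and R :: "'a gword set" where
  refl: "w \<in> gwords S \<Longrightarrow> pres_eq S R w w"
| sym: "pres_eq S R v w \<Longrightarrow> pres_eq S R w v"
| trans: "pres_eq S R u v \<Longrightarrow> pres_eq S R v w \<Longrightarrow> pres_eq S R u w"
| cancel: "u \<in> gwords S \<Longrightarrow> v \<in> gwords S \<Longrightarrow> x \<in> S \<Longrightarrow>
    pres_eq S R (u @ [(x, e), (x, \<not> e)] @ v) (u @ v)"
| relator: "u \<in> gwords S \<Longrightarrow> v \<in> gwords S \<Longrightarrow> w \<in> R \<Longrightarrow>
    pres_eq S R (u @ w @ v) (u @ v)"

(* The canonical map from the group presented by S and R to G is well defined and injective
   by the last condition, and surjective by the one before it. *)
definition has_presentation ::
  "('g, 'x) monoid_scheme \<Rightarrow> ('a \<Rightarrow> 'g) \<Rightarrow> 'a set \<Rightarrow> 'a gword set \<Rightarrow> bool" where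
  "has_presentation G r S R \<longleftrightarrow>
     r \<in> S \<rightarrow> carrier G \<and> R \<subseteq> gwords S \<and>
     generate G (r ` S) = carrier G \<and>
     (\<forall>v\<in>gwords S. \<forall>w\<in>gwords S. eval_gword G r v = eval_gword G r w \<longleftrightarrow> pres_eq S R v w)"

definition coxeter_matrix :: "'a set \<Rightarrow> ('a \<Rightarrow> 'a \<Rightarrow> enat) \<Rightarrow> bool" where
  "coxeter_matrix \<Delta> m \<longleftrightarrow>
     (\<forall>a\<in>\<Delta>. \<forall>b\<in>\<Delta>. m a b \<ge> 1 \<and> m a b = m b a \<and> (m a b = 1 \<longleftrightarrow> a = b))"

definition coxeter_relators :: "'a set \<Rightarrow> ('a \<Rightarrow> 'a \<Rightarrow> enat) \<Rightarrow> 'a gword set" where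
  "coxeter_relators \<Delta> m =
     {concat (replicate k [(a, True), (b, True)]) | a b k. a \<in> \<Delta> \<and> b \<in> \<Delta> \<and> m a b = enat k}"

locale coxeter_group = group W
  for W :: "('g, 'x) monoid_scheme" (structure) +
  fixes \<Delta> :: "'a set" and m :: "'a \<Rightarrow> 'a \<Rightarrow> enat" and r :: "'a \<Rightarrow> 'g"
  assumes matrix: "coxeter_matrix \<Delta> m"
    and presentation: "has_presentation W r \<Delta> (coxeter_relators \<Delta> m)"

definition is_reflection ::
  "('g, 'x) monoid_scheme \<Rightarrow> 'a set \<Rightarrow> ('a \<Rightarrow> 'g) \<Rightarrow> 'g \<Rightarrow> bool" where
  "is_reflection W \<Delta> r t \<longleftrightarrow>
     (\<exists>g\<in>carrier W. \<exists>a\<in>\<Delta>. t = g \<otimes>\<^bsub>W\<^esub> r a \<otimes>\<^bsub>W\<^esub> inv\<^bsub>W\<^esub> g)"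

definition is_parabolic ::
  "('g, 'x) monoid_scheme \<Rightarrow> 'a set \<Rightarrow> ('a \<Rightarrow> 'g) \<Rightarrow> 'g set \<Rightarrow> bool" where
  "is_parabolic W \<Delta> r P \<longleftrightarrow>
     (\<exists>g\<in>carrier W. \<exists>I\<subseteq>\<Delta>. P = (\<lambda>x. g \<otimes>\<^bsub>W\<^esub> x \<otimes>\<^bsub>W\<^esub> inv\<^bsub>W\<^esub> g) ` generate W (r ` I))"

definition maximal_finite_subgroup :: "('g, 'x) monoid_scheme \<Rightarrow> 'g set \<Rightarrow> bool" where
  "maximal_finite_subgroup G F \<longleftrightarrow>
     subgroup F G \<and> finite F \<and> (\<forall>H. subgroup H G \<and> finite H \<and> F \<subseteq> H \<longrightarrow> H = F)"

end

theory Submission imports Defs Complex_Main begin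

text \<open>
  Call the intersection of all maximal finite subgroups containing an element its finite continuation. It
  is defined by the abstract group alone, so isomorphisms preserve it. In a Coxeter group of finite rank,
  the finite continuation of an involution is a finite parabolic subgroup. If that of the generator r a
  had order 2, it would consist of 1 and r a; so the finite continuation of its image would consist of 1 and
  \<alpha> (r a) and be parabolic. A parabolic subgroup of order 2 is generated by a reflection, so \<alpha> (r a) would
  be a reflection. As r a is not trivial, the order is greater than 2.

  That finite continuations of involutions are parabolic rests on two facts: every finite subgroup lies
  in a finite parabolic subgroup (theorem \<open>finite_subgroup_in_parabolic\<close>), so that maximal finite subgroups
  are parabolic; and the intersection of a finite parabolic subgroup with a parabolic one is parabolic
  (theorem \<open>parabolic_inter\<close>). Maximal finite subgroups exist because finite rank bounds the orders of
  finite parabolic subgroups.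

  Both facts come from linear forms on the geometric representation. Every root is a nonnegative or a
  nonpositive combination of simple roots, according to whether a simple reflection increases or decreases the
  length (theorem \<open>nonneg_if_not_descent\<close>). Consequently a linear form that is negative on only finitely many
  positive roots can be moved to one that is nonnegative on the simple roots (theorem \<open>make_dominant\<close>),
  and the stabilizer of such a form is a standard subgroup (theorem \<open>stab_dominant\<close>). A finite subgroup
  fixes the average of the height over its elements; a parabolic subgroup is the stabilizer of some form.
\<close>

section \<open>Chebyshev polynomials of the second kind\<close>

text \<open>
  Alternating products of two simple reflections act on the plane of the two simple roots with
  coefficients sin (k * theta) / sin theta, where theta = pi / n is the angle between the mirrors.
  The recursive form below also covers an infinite bond, where the cosine is replaced by 1 and the
  coefficients become the numbers k.
\<close>
fun cheb :: "real \<Rightarrow> nat \<Rightarrow> real" where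
  "cheb c 0 = 0"
| "cheb c (Suc 0) = 1"
| "cheb c (Suc (Suc k)) = 2 * c * cheb c (Suc k) - cheb c k"

lemma cheb_cos: "cheb (cos t) k * sin t = sin (real k * t)"
proof (induction "cos t" k rule: cheb.induct)
  case (3 k)
  have "sin (real (Suc (Suc k)) * t) = sin (real (Suc k) * t + t)"
    and "sin (real k * t) = sin (real (Suc k) * t - t)"
    by (simp_all add: algebra_simps)
  hence "sin (real (Suc (Suc k)) * t) + sin (real k * t) = 2 * cos t * sin (real (Suc k) * t)"
    by (simp add: sin_add sin_diff)
  thus ?case using 3 by (simp add: algebra_simps)
qed simp_all

lemma cheb_1: "cheb 1 k = real k"
  by (induction "1::real" k rule: cheb.induct) simp_all

lemma sin_pi_div_pos: "sin (pi / real n) > 0" if "n \<ge> 2" for n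
  using that by (intro sin_gt_zero) (auto simp: field_simps)

text \<open>
  Positivity of the roots in rank two amounts to nonnegativity of the coefficients up to index n.
\<close>
lemma cheb_nonneg:
  assumes "n \<ge> 2" and "k \<le> n"
  shows "cheb (cos (pi / real n)) k \<ge> 0"
proof -
  have "sin (real k * (pi / real n)) \<ge> 0"
    using assms by (intro sin_ge_zero) (auto simp: field_simps)
  thus ?thesis
    using sin_pi_div_pos[OF assms(1)] cheb_cos[of "pi / real n" k]
    by (metis mult_less_0_iff not_less)
qed

text \<open>
  The product of two simple reflections turns their plane by 2 * pi / n, so its n-th power is trivial there.
\<close>
lemma cheb_periodic:
  assumes "n \<ge> 2"
  shows "cheb (cos (pi / real n)) (k + 2 * n) = cheb (cos (pi / real n)) k"
proof -
  have "real (k + 2 * n) * (pi / real n) = real k * (pi / real n) + 2 * pi"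
    using assms by (simp add: field_simps)
  hence "sin (real (k + 2 * n) * (pi / real n)) = sin (real k * (pi / real n))"
    by (simp only: sin_periodic)
  thus ?thesis
    using sin_pi_div_pos[OF assms] cheb_cos[of "pi / real n"] by (metis less_irrefl mult_cancel_right)
qed

section \<open>Linear forms on functions\<close>

text \<open>
  The geometric representation lives on all functions from the index type to the reals. Linearity is
  expressed through a single operation on such functions, which keeps terms of the form p u + q v
  first-order for rewriting.
\<close>
definition lincomb :: "real \<Rightarrow> ('a \<Rightarrow> real) \<Rightarrow> real \<Rightarrow> ('a \<Rightarrow> real) \<Rightarrow> 'a \<Rightarrow> real" where
  "lincomb p u q v = (\<lambda>x. p * u x + q * v x)"

definition linear_form :: "(('a \<Rightarrow> real) \<Rightarrow> real) \<Rightarrow> bool" where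
  "linear_form \<mu> \<longleftrightarrow> (\<forall>p u q v. \<mu> (lincomb p u q v) = p * \<mu> u + q * \<mu> v)"

definition simple_root :: "'a \<Rightarrow> 'a \<Rightarrow> real" where
  "simple_root a = (\<lambda>x. if x = a then 1 else 0)"

lemma linear_form_zero:
  assumes "linear_form \<mu>" shows "\<mu> (\<lambda>_. 0) = 0"
proof -
  have "\<mu> (lincomb 0 (\<lambda>_. 0) 0 (\<lambda>_. 0)) = 0"
    using assms unfolding linear_form_def by simp
  thus ?thesis by (simp add: lincomb_def)
qed

lemma linear_form_uminus: "linear_form \<mu> \<Longrightarrow> \<mu> (\<lambda>x. - v x) = - \<mu> v"
  unfolding linear_form_def
  by (drule spec[of _ "-1"], drule spec[of _ v], drule spec[of _ 0], drule spec[of _ v])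
    (simp add: lincomb_def)

lemma linear_form_expand:
  assumes "linear_form \<mu>" "finite I" "\<And>x. x \<notin> I \<Longrightarrow> v x = 0"
  shows "\<mu> v = (\<Sum>b\<in>I. v b * \<mu> (simple_root b))"
  using assms(2,3)
proof (induction I arbitrary: v rule: finite_induct)
  case empty
  hence "v = (\<lambda>_. 0)" by auto
  thus ?case using linear_form_zero[OF assms(1)] by simp
next
  case (insert a I)
  have eq: "v = lincomb 1 (v(a := 0)) (v a) (simple_root a)"
    by (auto simp: lincomb_def simple_root_def)
  have "\<mu> v = \<mu> (v(a := 0)) + v a * \<mu> (simple_root a)"
    by (subst eq) (use assms(1) in \<open>simp add: linear_form_def\<close>)
  moreover have "\<mu> (v(a := 0)) = (\<Sum>b\<in>I. (v(a := 0)) b * \<mu> (simple_root b))"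
    using insert.prems by (intro insert.IH) auto
  moreover have "\<dots> = (\<Sum>b\<in>I. v b * \<mu> (simple_root b))"
    using insert.hyps by (intro sum.cong) auto
  ultimately show ?case using insert.hyps by simp
qed

section \<open>The geometric representation\<close>

locale finite_rank_coxeter_group = coxeter_group W \<Delta> m r
  for W :: "('g, 'x) monoid_scheme" (structure) and \<Delta> :: "'a set"
    and m :: "'a \<Rightarrow> 'a \<Rightarrow> enat" and r :: "'a \<Rightarrow> 'g" +
  assumes finite_rank: "finite \<Delta>"
begin

lemma m_sym: "a \<in> \<Delta> \<Longrightarrow> b \<in> \<Delta> \<Longrightarrow> m a b = m b a"
  using matrix by (auto simp: coxeter_matrix_def)

lemma m_diag: "a \<in> \<Delta> \<Longrightarrow> m a a = 1"
  using matrix by (auto simp: coxeter_matrix_def)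

lemma m_ge_2: "a \<in> \<Delta> \<Longrightarrow> b \<in> \<Delta> \<Longrightarrow> a \<noteq> b \<Longrightarrow> m a b = enat n \<Longrightarrow> n \<ge> 2"
  using matrix unfolding coxeter_matrix_def
  by (metis One_nat_def Suc_1 Suc_leI enat_ord_simps(1) le_neq_implies_less one_enat_def)

text \<open>
  The Gram matrix of the simple roots is the negative of this matrix; an infinite bond gets the limiting
  value cos 0 = 1, and the diagonal entries are cos pi = -1, so that simple roots have norm 1.
\<close>
definition cosine :: "'a \<Rightarrow> 'a \<Rightarrow> real" where
  "cosine a b = (case m a b of enat n \<Rightarrow> cos (pi / real n) | \<infinity> \<Rightarrow> 1)"

text \<open>
  Pairing with the simple root at a under the symmetric bilinear form given by the Gram matrix.
\<close>
definition coroot :: "'a \<Rightarrow> ('a \<Rightarrow> real) \<Rightarrow> real" where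
  "coroot a v = - (\<Sum>b\<in>\<Delta>. cosine a b * v b)"

definition reflection :: "'a \<Rightarrow> ('a \<Rightarrow> real) \<Rightarrow> 'a \<Rightarrow> real" where
  "reflection a v = lincomb 1 v (- 2 * coroot a v) (simple_root a)"

lemma cosine_sym: "a \<in> \<Delta> \<Longrightarrow> b \<in> \<Delta> \<Longrightarrow> cosine a b = cosine b a"
  by (simp add: cosine_def m_sym)

lemma cosine_diag: "a \<in> \<Delta> \<Longrightarrow> cosine a a = - 1"
  by (simp add: cosine_def m_diag one_enat_def)

lemma linear_coroot: "linear_form (coroot a)"
  by (simp add: linear_form_def coroot_def lincomb_def algebra_simps sum.distrib sum_distrib_left)

lemma coroot_lincomb: "coroot a (lincomb p u q v) = p * coroot a u + q * coroot a v"
  using linear_coroot by (simp add: linear_form_def)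

lemma coroot_simple_root: "b \<in> \<Delta> \<Longrightarrow> coroot a (simple_root b) = - cosine a b"
  using finite_rank by (simp add: coroot_def simple_root_def if_distrib cong: if_cong)

lemma reflection_lincomb: "reflection a (lincomb p u q v) = lincomb p (reflection a u) q (reflection a v)"
  by (simp only: reflection_def coroot_lincomb) (simp add: lincomb_def fun_eq_iff algebra_simps)

lemma reflection_simple_root: "b \<in> \<Delta> \<Longrightarrow> reflection a (simple_root b) =
    lincomb 1 (simple_root b) (2 * cosine a b) (simple_root a)"
  by (simp add: reflection_def coroot_simple_root)

lemma reflection_simple_root_self: "a \<in> \<Delta> \<Longrightarrow> reflection a (simple_root a) = (\<lambda>x. - simple_root a x)"
  by (auto simp: reflection_simple_root cosine_diag lincomb_def)

lemma reflection_reflection: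
  assumes "a \<in> \<Delta>" shows "reflection a (reflection a v) = v"
proof -
  have "coroot a (reflection a v) = - coroot a v"
    using assms by (simp add: reflection_def coroot_lincomb coroot_simple_root cosine_diag)
  thus ?thesis by (simp add: reflection_def[of a "reflection a v"]) (simp add: reflection_def lincomb_def)
qed

text \<open>
  Each further reflection shifts the index of the Chebyshev coefficients by one and swaps the two simple
  roots, by the recursion for the coefficients.
\<close>
lemma reflection_step:
  assumes "a \<in> \<Delta>" "b \<in> \<Delta>"
  shows "reflection a (lincomb (cheb (cosine a b) k) (simple_root a) (cheb (cosine a b) (Suc k)) (simple_root b))
    = lincomb (cheb (cosine a b) (Suc k)) (simple_root b) (cheb (cosine a b) (Suc (Suc k))) (simple_root a)"
  using assms by (simp add: reflection_lincomb reflection_simple_root cosine_diag)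
     (simp add: lincomb_def fun_eq_iff algebra_simps)

lemma rotation_power:
  assumes "a \<in> \<Delta>" "b \<in> \<Delta>"
  shows "((reflection a \<circ> reflection b) ^^ j) (lincomb (cheb (cosine a b) k) (simple_root b) (cheb (cosine a b) (Suc k)) (simple_root a))
    = lincomb (cheb (cosine a b) (k + 2 * j)) (simple_root b) (cheb (cosine a b) (Suc (k + 2 * j))) (simple_root a)"
proof (induction j)
  case (Suc j)
  have "((reflection a \<circ> reflection b) ^^ Suc j) v = reflection a (reflection b (((reflection a \<circ> reflection b) ^^ j) v))" for v
    by simp
  moreover have "k + 2 * Suc j = Suc (Suc (k + 2 * j))" by simp
  ultimately show ?case
    using reflection_step[OF assms, of "Suc (k + 2 * j)"] reflection_step[OF assms(2,1), of "k + 2 * j"]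
    by (simp only: Suc.IH cosine_sym[OF assms(2,1)])
qed simp

lemma rotation_lincomb:
  "((reflection a \<circ> reflection b) ^^ j) (lincomb p u q v)
     = lincomb p (((reflection a \<circ> reflection b) ^^ j) u) q (((reflection a \<circ> reflection b) ^^ j) v)"
  by (induction j) (simp_all add: reflection_lincomb)

lemma rotation_fixes:
  assumes "coroot a v = 0" "coroot b v = 0"
  shows "((reflection a \<circ> reflection b) ^^ j) v = v"
  using assms by (induction j) (simp_all add: reflection_def lincomb_def)

text \<open>
  The product of two simple reflections is trivial on the vectors orthogonal to both roots, and on the
  plane of the two roots its n-th power is trivial by periodicity of the Chebyshev coefficients. The two
  parts span everything because the form is nondegenerate on the plane: its determinant is
  the square of sin (pi / n).
\<close>
lemma rotation_order:
  assumes ab: "a \<in> \<Delta>" "b \<in> \<Delta>" and n: "m a b = enat n"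
  shows "((reflection a \<circ> reflection b) ^^ n) v = v"
proof (cases "a = b")
  case True
  hence "reflection a \<circ> reflection b = id" using ab by (auto simp: reflection_reflection)
  thus ?thesis by simp
next
  case False
  have n2: "n \<ge> 2" using m_ge_2 ab False n by blast
  define c where "c = cosine a b"
  define t where "t = pi / real n"
  have c: "c = cos t" by (simp add: c_def cosine_def n t_def)
  have s: "sin t > 0" using sin_pi_div_pos[OF n2] by (simp add: t_def)
  have per: "cheb c (k + 2 * n) = cheb c k" for k
    using cheb_periodic[OF n2] by (simp add: c t_def)
  have per': "cheb c (Suc (k + 2 * n)) = cheb c (Suc k)" for k
    using per[of "Suc k"] by simp
  define R where "R = (reflection a \<circ> reflection b) ^^ n"
  have R: "R (lincomb p u q v) = lincomb p (R u) q (R v)" for p u q v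
    by (simp add: R_def rotation_lincomb)
  have Rk: "R (lincomb (cheb c k) (simple_root b) (cheb c (Suc k)) (simple_root a))
     = lincomb (cheb c k) (simple_root b) (cheb c (Suc k)) (simple_root a)" for k
    using rotation_power[OF ab, of n k] by (simp only: R_def c_def[symmetric] per per')
  have Ra: "R (simple_root a) = simple_root a"
    using Rk[of 0] by (simp add: lincomb_def)
  have Rb: "R (simple_root b) = simple_root b"
    using Rk[of 1] by (simp add: R Ra) (simp add: lincomb_def fun_eq_iff)
  \<comment> \<open>The component of v in the plane of the two roots, from the 2x2 Gram system with determinant d.\<close>
  define d where "d = 1 - c * c"
  have d: "d > 0" using s sin_squared_eq[of t] zero_less_power[OF s, of 2]
    by (simp add: d_def c power2_eq_square)
  define x where "x = (coroot a v + c * coroot b v) / d"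
  define y where "y = (coroot b v + c * coroot a v) / d"
  define u where "u = lincomb 1 v (-1) (lincomb x (simple_root a) y (simple_root b))"
  have ba: "cosine b a = c" using cosine_sym ab by (simp add: c_def)
  have xy: "x - c * y = coroot a v" "y - c * x = coroot b v"
  proof -
    have "x * d = coroot a v + c * coroot b v" "y * d = coroot b v + c * coroot a v"
      using d by (simp_all add: x_def y_def)
    hence "(x - c * y) * d = coroot a v * d" "(y - c * x) * d = coroot b v * d"
      by (simp_all add: left_diff_distrib mult.assoc) (simp_all add: d_def algebra_simps)
    thus "x - c * y = coroot a v" "y - c * x = coroot b v" using d by simp_all
  qed
  have "coroot a u = 0" "coroot b u = 0"
    using ab xy by (simp_all add: u_def coroot_lincomb coroot_simple_root cosine_diag ba algebra_simps
        flip: c_def)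
  hence Ru: "R u = u" by (simp add: R_def rotation_fixes)
  have v: "v = lincomb 1 u 1 (lincomb x (simple_root a) y (simple_root b))"
    by (simp add: u_def lincomb_def)
  have "R v = lincomb 1 (R u) 1 (lincomb x (R (simple_root a)) y (R (simple_root b)))"
    by (subst v) (simp only: R)
  also have "\<dots> = v" by (subst v) (simp only: Ra Rb Ru)
  finally show ?thesis by (simp add: R_def)
qed

text \<open>
  All roots have norm 1 under this invariant quadratic form, so they do not vanish, and a positive root that
  is a multiple of a simple root is equal to it.
\<close>
definition qform :: "('a \<Rightarrow> real) \<Rightarrow> real" where
  "qform v = (\<Sum>a\<in>\<Delta>. v a * coroot a v)"

lemma qform_reflection:
  assumes a: "a \<in> \<Delta>" shows "qform (reflection a v) = qform v"
proof -
  define y where "y = 2 * coroot a v"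
  have co: "coroot b (reflection a v) = coroot b v + y * cosine b a" for b
    using a by (simp add: reflection_def coroot_lincomb coroot_simple_root y_def)
  have s1: "(\<Sum>b\<in>\<Delta>. v b * cosine b a) = - coroot a v"
    unfolding coroot_def using a
    by (simp add: sum_negf cosine_sym[of a] mult.commute)
  have s2: "(\<Sum>b\<in>\<Delta>. simple_root a b * g b) = g a" for g
    using finite_rank a by (simp add: simple_root_def if_distribR if_distrib cong: if_cong)
  have "qform (reflection a v) = (\<Sum>b\<in>\<Delta>. (v b - y * simple_root a b) * (coroot b v + y * cosine b a))"
    unfolding qform_def co by (simp add: reflection_def lincomb_def y_def)
  also have "\<dots> = qform v + y * (\<Sum>b\<in>\<Delta>. v b * cosine b a)
      - y * (\<Sum>b\<in>\<Delta>. simple_root a b * (coroot b v + y * cosine b a))"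
    by (simp add: qform_def algebra_simps sum.distrib sum_subtractf sum_distrib_left)
  also have "\<dots> = qform v" using a unfolding s1 s2 by (simp add: y_def cosine_diag algebra_simps)
  finally show ?thesis .
qed

section \<open>From the presentation to the representation\<close>

lemma r_closed [simp]: "a \<in> \<Delta> \<Longrightarrow> r a \<in> carrier W"
  using presentation unfolding has_presentation_def by blast

lemma generate_all: "generate W (r ` \<Delta>) = carrier W"
  using presentation unfolding has_presentation_def by blast

lemma relator_in_gwords: "w \<in> coxeter_relators \<Delta> m \<Longrightarrow> w \<in> gwords \<Delta>"
  using presentation unfolding has_presentation_def by blast

lemma eval_eq_iff_pres_eq:
  "v \<in> gwords \<Delta> \<Longrightarrow> w \<in> gwords \<Delta> \<Longrightarrow>
    eval_gword W r v = eval_gword W r w \<longleftrightarrow> pres_eq \<Delta> (coxeter_relators \<Delta> m) v w"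
  using presentation unfolding has_presentation_def by blast

lemma eval_closed: "w \<in> gwords \<Delta> \<Longrightarrow> eval_gword W r w \<in> carrier W"
  by (induction w) (auto simp: gwords_def)

lemma eval_append: "v \<in> gwords \<Delta> \<Longrightarrow> w \<in> gwords \<Delta> \<Longrightarrow>
    eval_gword W r (v @ w) = eval_gword W r v \<otimes> eval_gword W r w"
proof (induction v)
  case Nil thus ?case by (simp add: eval_closed)
next
  case (Cons l v)
  hence "v \<in> gwords \<Delta>" "fst l \<in> \<Delta>" by (auto simp: gwords_def)
  thus ?case using Cons by (simp add: m_assoc eval_closed)
qed

lemma eval_surj:
  assumes "g \<in> carrier W" shows "\<exists>w\<in>gwords \<Delta>. eval_gword W r w = g"
  using assms unfolding generate_all[symmetric]
proof (induction rule: generate.induct)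
  case one show ?case by (intro bexI[of _ "[]"]) (auto simp: gwords_def)
next
  case (incl h)
  then obtain a where "a \<in> \<Delta>" "h = r a" by auto
  thus ?case by (intro bexI[of _ "[(a, True)]"]) (auto simp: gwords_def)
next
  case (inv h)
  then obtain a where "a \<in> \<Delta>" "h = r a" by auto
  thus ?case by (intro bexI[of _ "[(a, False)]"]) (auto simp: gwords_def)
next
  case (eng h1 h2)
  then obtain v w where "v \<in> gwords \<Delta>" "w \<in> gwords \<Delta>"
    "eval_gword W r v = h1" "eval_gword W r w = h2" by auto
  thus ?case by (intro bexI[of _ "v @ w"]) (auto simp: eval_append gwords_def)
qed

primrec act :: "'a gword \<Rightarrow> ('a \<Rightarrow> real) \<Rightarrow> 'a \<Rightarrow> real" where
  "act [] = id"
| "act (l # w) = reflection (fst l) \<circ> act w"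

lemma act_append: "act (v @ w) = act v \<circ> act w"
  by (induction v) (simp_all add: o_assoc)

lemma act_power: "act (concat (replicate k [(a, e), (b, f)])) = (reflection a \<circ> reflection b) ^^ k"
  by (induction k) (simp_all add: o_assoc)

text \<open>
  The defining relations hold for the reflections, so the action of words descends to the group.
\<close>
lemma pres_eq_act:
  "pres_eq \<Delta> (coxeter_relators \<Delta> m) v w \<Longrightarrow> act v = act w"
proof (induction rule: pres_eq.induct)
  case (cancel u v x e)
  thus ?case by (simp add: act_append fun_eq_iff reflection_reflection)
next
  case (relator u v w)
  then obtain a b k where "w = concat (replicate k [(a, True), (b, True)])"
    "a \<in> \<Delta>" "b \<in> \<Delta>" "m a b = enat k" by (auto simp: coxeter_relators_def)
  hence "act w = id" by (auto simp: act_power rotation_order)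
  thus ?case by (simp add: act_append)
next
  case (sym v w) show ?case using sym.IH by (rule HOL.sym)
next
  case (trans u v w) show ?case using trans.IH by (rule HOL.trans)
qed (rule HOL.refl)

definition rho :: "'g \<Rightarrow> ('a \<Rightarrow> real) \<Rightarrow> 'a \<Rightarrow> real" where
  "rho g = act (SOME w. w \<in> gwords \<Delta> \<and> eval_gword W r w = g)"

lemma rho_eval:
  assumes "w \<in> gwords \<Delta>" shows "rho (eval_gword W r w) = act w"
proof -
  define v where "v = (SOME v. v \<in> gwords \<Delta> \<and> eval_gword W r v = eval_gword W r w)"
  have "v \<in> gwords \<Delta> \<and> eval_gword W r v = eval_gword W r w"
    unfolding v_def by (rule someI[of _ w]) (simp add: assms)
  hence "act v = act w"
    using assms eval_eq_iff_pres_eq pres_eq_act by blast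
  thus ?thesis by (simp add: rho_def v_def)
qed

lemma rho_one [simp]: "rho \<one> = id"
  using rho_eval[of "[]"] by (simp add: gwords_def)

lemma rho_generator: "a \<in> \<Delta> \<Longrightarrow> rho (r a) = reflection a"
  using rho_eval[of "[(a, True)]"] by (simp add: gwords_def)

lemma rho_mult:
  assumes "g \<in> carrier W" "h \<in> carrier W" shows "rho (g \<otimes> h) v = rho g (rho h v)"
proof -
  obtain u w where "u \<in> gwords \<Delta>" "w \<in> gwords \<Delta>"
    "eval_gword W r u = g" "eval_gword W r w = h" using assms eval_surj by metis
  thus ?thesis using rho_eval[of "u @ w"] rho_eval[of u] rho_eval[of w]
    by (simp add: eval_append act_append gwords_def)
qed

lemma rho_inv [simp]:
  assumes "g \<in> carrier W" shows "rho (inv g) (rho g v) = v" "rho g (rho (inv g) v) = v"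
  using assms rho_mult[of "inv g" g v] rho_mult[of g "inv g" v] by simp_all

lemma eval_relator:
  assumes "a \<in> \<Delta>" "b \<in> \<Delta>" "m a b = enat n"
  shows "eval_gword W r (concat (replicate n [(a, True), (b, True)])) = \<one>"
proof -
  define w where "w = concat (replicate n [(a, True), (b, True)])"
  have w: "w \<in> coxeter_relators \<Delta> m" using assms by (auto simp: coxeter_relators_def w_def)
  have nil: "[] \<in> gwords \<Delta>" by (simp add: gwords_def)
  have "pres_eq \<Delta> (coxeter_relators \<Delta> m) w []"
    using pres_eq.relator[OF nil nil w] by simp
  hence "eval_gword W r w = eval_gword W r []"
    using eval_eq_iff_pres_eq[OF relator_in_gwords[OF w] nil] by blast
  thus ?thesis by (simp add: w_def)
qed

lemma r_sq [simp]: assumes "a \<in> \<Delta>" shows "r a \<otimes> r a = \<one>"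
  using eval_relator[OF assms assms, of 1] assms by (simp add: m_diag one_enat_def)

lemma r_cancel: "a \<in> \<Delta> \<Longrightarrow> g \<in> carrier W \<Longrightarrow> g \<otimes> r a \<otimes> r a = g"
  by (simp add: m_assoc)

lemma r_self_inverse: "a \<in> \<Delta> \<Longrightarrow> inv (r a) = r a"
  by (simp add: inv_equality)

text \<open>
  The generator negates its simple root, so it cannot be trivial.
\<close>
lemma r_ne_one: assumes "a \<in> \<Delta>" shows "r a \<noteq> \<one>"
proof
  assume "r a = \<one>"
  hence "rho (r a) (simple_root a) a = simple_root a a" by simp
  thus False using assms
    by (simp only: rho_generator reflection_simple_root_self) (simp add: simple_root_def)
qed

section \<open>Words and length\<close>

declare in_lists_conv_set [simp]

text \<open>
  Generators are involutions, so words without formal inverses suffice.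
\<close>
primrec word :: "'a list \<Rightarrow> 'g" where
  "word [] = \<one>"
| "word (a # xs) = r a \<otimes> word xs"

lemma word_closed [simp]: "xs \<in> lists \<Delta> \<Longrightarrow> word xs \<in> carrier W"
  by (induction xs) auto

lemma word_append: "xs \<in> lists \<Delta> \<Longrightarrow> ys \<in> lists \<Delta> \<Longrightarrow> word (xs @ ys) = word xs \<otimes> word ys"
  by (induction xs) (auto simp: m_assoc)

lemma word_rev: "xs \<in> lists \<Delta> \<Longrightarrow> word (rev xs) = inv (word xs)"
  by (induction xs) (auto simp: word_append inv_mult_group r_self_inverse)

lemma word_relator:
  assumes "a \<in> \<Delta>" "b \<in> \<Delta>" "m a b = enat n"
  shows "word (concat (replicate n [a, b])) = \<one>"
proof -
  have "word xs = eval_gword W r (map (\<lambda>a. (a, True)) xs)" for xs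
    by (induction xs) simp_all
  thus ?thesis using eval_relator[OF assms] by (simp add: map_concat)
qed

lemma generate_eq_words:
  assumes "I \<subseteq> \<Delta>" shows "generate W (r ` I) = word ` lists I"
proof (intro equalityI subsetI)
  fix g assume "g \<in> generate W (r ` I)"
  thus "g \<in> word ` lists I"
  proof (induction rule: generate.induct)
    case one show ?case by (intro image_eqI[of _ _ "[]"]) auto
  next
    case (incl h)
    then obtain a where "a \<in> I" "h = r a" by auto
    thus ?case using assms by (intro image_eqI[of _ _ "[a]"]) auto
  next
    case (inv h)
    then obtain a where "a \<in> I" "h = r a" by auto
    thus ?case using assms by (intro image_eqI[of _ _ "[a]"]) (auto simp: r_self_inverse)
  next
    case (eng h1 h2)
    then obtain v w where vw: "v \<in> lists I" "w \<in> lists I" "word v = h1" "word w = h2" by auto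
    moreover from vw have "v \<in> lists \<Delta>" "w \<in> lists \<Delta>" using assms by auto
    ultimately show ?case by (intro image_eqI[of _ _ "v @ w"]) (auto simp: word_append)
  qed
next
  fix g assume "g \<in> word ` lists I"
  then obtain xs where "xs \<in> lists I" "g = word xs" by auto
  moreover have "xs \<in> lists I \<Longrightarrow> word xs \<in> generate W (r ` I)"
    by (induction xs) (auto intro: generate.intros)
  ultimately show "g \<in> generate W (r ` I)" by simp
qed

lemma standard_subgroup: "I \<subseteq> \<Delta> \<Longrightarrow> subgroup (generate W (r ` I)) W"
  by (intro generate_is_subgroup) auto

lemma standard_carrier: "I \<subseteq> \<Delta> \<Longrightarrow> g \<in> generate W (r ` I) \<Longrightarrow> g \<in> carrier W"
  using standard_subgroup subgroup.mem_carrier by metis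

lemma standard_generator: "a \<in> I \<Longrightarrow> r a \<in> generate W (r ` I)"
  by (auto intro: generate.incl)

lemma rho_lincomb:
  assumes "g \<in> carrier W"
  shows "rho g (lincomb p u q v) = lincomb p (rho g u) q (rho g v)"
proof -
  obtain w where "w \<in> gwords \<Delta>" "eval_gword W r w = g" using eval_surj assms by auto
  moreover have "act w (lincomb p u q v) = lincomb p (act w u) q (act w v)"
    by (induction w) (simp_all add: reflection_lincomb)
  ultimately show ?thesis using rho_eval by metis
qed

lemma rho_uminus:
  assumes "g \<in> carrier W" shows "rho g (\<lambda>x. - v x) = (\<lambda>x. - rho g v x)"
  using rho_lincomb[OF assms, of "-1" v 0 v] by (simp add: lincomb_def)

lemma qform_rho:
  assumes "g \<in> carrier W" shows "qform (rho g v) = qform v"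
proof -
  obtain w where w: "w \<in> gwords \<Delta>" "eval_gword W r w = g" using eval_surj assms by auto
  hence "qform (act w v) = qform v"
    by (induction w arbitrary: g) (auto simp: gwords_def qform_reflection)
  thus ?thesis using rho_eval w by metis
qed

text \<open>
  The length is taken with respect to the generators of a standard subgroup, not of the whole group. This
  lets the positivity theorem be proved for all standard subgroups at once, without comparing their length
  functions.
\<close>
definition len :: "'a set \<Rightarrow> 'g \<Rightarrow> nat" where
  "len I g = (LEAST n. \<exists>xs\<in>lists I. word xs = g \<and> length xs = n)"

lemma len_word_le: "xs \<in> lists I \<Longrightarrow> len I (word xs) \<le> length xs"
  unfolding len_def by (intro Least_le) auto

lemma len_witness:
  assumes "I \<subseteq> \<Delta>" "g \<in> generate W (r ` I)"
  obtains xs where "xs \<in> lists I" "word xs = g" "length xs = len I g"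
proof -
  from assms obtain ys where "ys \<in> lists I" "word ys = g"
    by (auto simp: generate_eq_words)
  hence "\<exists>n. \<exists>xs\<in>lists I. word xs = g \<and> length xs = n" by blast
  hence "\<exists>xs\<in>lists I. word xs = g \<and> length xs = len I g"
    unfolding len_def by (rule LeastI_ex)
  thus ?thesis using that by auto
qed

lemma len_mult_word:
  assumes I: "I \<subseteq> \<Delta>" "g \<in> generate W (r ` I)" "ys \<in> lists I"
  shows "len I (g \<otimes> word ys) \<le> len I g + length ys"
proof -
  obtain xs where xs: "xs \<in> lists I" "word xs = g" "length xs = len I g"
    using len_witness[OF I(1,2)] .
  have "xs \<in> lists \<Delta>" "ys \<in> lists \<Delta>" using I xs by auto
  hence "word (xs @ ys) = g \<otimes> word ys" by (simp add: word_append xs)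
  moreover have "len I (word (xs @ ys)) \<le> length (xs @ ys)"
    using I xs by (intro len_word_le) auto
  ultimately show ?thesis using xs by simp
qed

lemma descent_exists:
  assumes I: "I \<subseteq> \<Delta>" "g \<in> generate W (r ` I)" "g \<noteq> \<one>"
  obtains t where "t \<in> I" "len I (g \<otimes> r t) < len I g"
proof -
  obtain xs where xs: "xs \<in> lists I" "word xs = g" "length xs = len I g"
    using len_witness[OF I(1,2)] .
  hence "xs \<noteq> []" using I by auto
  then obtain ys t where ys: "xs = ys @ [t]" by (metis rev_exhaust)
  have t: "t \<in> I" "t \<in> \<Delta>" "ys \<in> lists I" "ys \<in> lists \<Delta>" using ys xs I by auto
  hence "g \<otimes> r t = word ys"
    using xs ys by (auto simp: word_append m_assoc)
  hence "len I (g \<otimes> r t) \<le> length ys" using len_word_le t by metis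
  thus ?thesis using that t xs ys by simp
qed

section \<open>Positivity of roots\<close>

text \<open>
  Built from the left, so that for given s and t the nonempty words all end in t and each word is a suffix
  of the next. Splitting off the next word from the right of a group element thus takes one more generator.
\<close>
primrec alt :: "'a \<Rightarrow> 'a \<Rightarrow> nat \<Rightarrow> 'a list" where
  "alt s t 0 = []"
| "alt s t (Suc k) = (if even k then t else s) # alt s t k"

lemma length_alt [simp]: "length (alt s t k) = k"
  by (induction k) simp_all

lemma alt_in_lists: "s \<in> I \<Longrightarrow> t \<in> I \<Longrightarrow> alt s t k \<in> lists I"
  by (induction k) simp_all

lemma alt_Suc_right: "alt t s (Suc k) = alt s t k @ [s]"
  by (induction k) simp_all

lemma alt_split: "\<exists>xs. xs \<in> lists {s, t} \<and> length xs = j \<and> alt s t (j + k) = xs @ alt s t k"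
proof (induction j)
  case (Suc j)
  then obtain xs where "xs \<in> lists {s, t} \<and> length xs = j \<and> alt s t (j + k) = xs @ alt s t k" ..
  thus ?case by (intro exI[of _ "(if even (j + k) then t else s) # xs"]) simp
qed simp

lemma alt_even: "alt s t (2 * n) = concat (replicate n [s, t])"
  by (induction n) simp_all

text \<open>
  The alternating word of length 2 * n represents 1, so one of length n + 1 equals the inverse of the
  complementary one of length n - 1. Hence an alternating word of length at least n becomes shorter when
  the other letter is appended.
\<close>
lemma alt_shorten:
  assumes "s \<in> \<Delta>" "t \<in> \<Delta>" "m s t = enat n" "n \<ge> 1" "n \<le> k"
  shows "\<exists>xs\<in>lists {s, t}. length xs < k \<and> word xs = word (alt s t k @ [s])"
proof -
  have [simp]: "xs \<in> lists {s, t} \<Longrightarrow> xs \<in> lists \<Delta>" for xs using assms by auto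
  obtain ys where ys: "ys \<in> lists {t, s}" "length ys = n - 1"
      "alt t s ((n - 1) + (n + 1)) = ys @ alt t s (n + 1)"
    using alt_split[of t s "n - 1" "n + 1"] by blast
  have ys': "ys \<in> lists \<Delta>" using ys assms by auto
  have al: "alt t s j \<in> lists \<Delta>" for j using alt_in_lists assms by metis
  have "(n - 1) + (n + 1) = 2 * n" using assms by simp
  hence "word ys \<otimes> word (alt t s (n + 1)) = \<one>"
    using ys(3) word_relator[of t s n] assms m_sym[of s t]
    by (simp only: word_append[OF ys' al, symmetric] alt_even)
  hence *: "word (alt t s (n + 1)) = word (rev ys)"
    using ys' al by (metis word_closed word_rev inv_comm inv_equality)
  obtain zs where zs: "zs \<in> lists {t, s}" "length zs = k - n"
      "alt t s ((k - n) + (n + 1)) = zs @ alt t s (n + 1)"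
    using alt_split[of t s "k - n" "n + 1"] by blast
  have zs': "zs \<in> lists \<Delta>" using zs assms by auto
  have "alt s t k @ [s] = zs @ alt t s (n + 1)"
    using zs assms by (simp flip: alt_Suc_right)
  moreover have "rev ys \<in> lists \<Delta>" using ys' by simp
  ultimately have "word (alt s t k @ [s]) = word (zs @ rev ys)"
    using word_append[OF zs' al] word_append[OF zs'] * by metis
  moreover have "zs @ rev ys \<in> lists {s, t}" "length (zs @ rev ys) < k"
    using zs ys assms by auto
  ultimately show ?thesis by metis
qed

lemma alt_simple_root:
  assumes "s \<in> \<Delta>" "t \<in> \<Delta>"
  shows "rho (word (alt s t k)) (simple_root s) =
    lincomb (cheb (cosine s t) k) (simple_root (if even k then t else s))
            (cheb (cosine s t) (Suc k)) (simple_root (if even k then s else t))"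
proof (induction k)
  case 0 show ?case by (simp add: lincomb_def)
next
  case (Suc k)
  have al: "word (alt s t k) \<in> carrier W" using alt_in_lists assms by (metis word_closed)
  have ts: "cosine t s = cosine s t" using assms cosine_sym by metis
  show ?case
    using reflection_step[OF assms, of k] reflection_step[OF assms(2,1), of k] assms al ts
    by (simp add: rho_mult rho_generator Suc.IH del: cheb.simps)
qed

lemma cheb_cosine_nonneg:
  assumes "s \<in> \<Delta>" "t \<in> \<Delta>" "s \<noteq> t" "\<And>n. m s t = enat n \<Longrightarrow> k \<le> n"
  shows "cheb (cosine s t) k \<ge> 0"
proof (cases "m s t")
  case (enat n)
  thus ?thesis using cheb_nonneg[OF m_ge_2[OF assms(1-3) enat]] assms(4) by (simp add: cosine_def)
next
  case infinity
  thus ?thesis by (simp add: cosine_def cheb_1)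
qed

definition nonneg :: "('a \<Rightarrow> real) \<Rightarrow> bool" where
  "nonneg v \<longleftrightarrow> (\<forall>x. 0 \<le> v x)"

text \<open>
  Induction on the length of w. Let t be a descent of w and strip from w the longest alternating suffix in s
  and t, ending in t, that accounts for its full length; write w = v p accordingly. Neither s nor t is a descent
  of v: one of them undoes the last stripping step, which makes v longer again; the other would allow a
  further step if it made v shorter. So v sends both simple roots to nonnegative vectors by induction. The
  suffix p has fewer than m s t letters, since otherwise p, and with it w, would become shorter when s is
  appended. Therefore p sends the simple root of s to a nonnegative combination of the two simple roots,
  with Chebyshev coefficients.
\<close>
theorem nonneg_if_not_descent:
  assumes I: "I \<subseteq> \<Delta>"
  shows "w \<in> generate W (r ` I) \<Longrightarrow> s \<in> I \<Longrightarrow> \<not> len I (w \<otimes> r s) < len I w \<Longrightarrow>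
    nonneg (rho w (simple_root s))"
proof (induction "len I w" arbitrary: w s rule: less_induct)
  case less
  show ?case
  proof (cases "w = \<one>")
    case True thus ?thesis by (simp add: nonneg_def simple_root_def)
  next
    case False
    have wc: "w \<in> carrier W" and s: "s \<in> \<Delta>" using less.prems I standard_carrier by auto
    note sub = standard_subgroup[OF I]
    obtain t where t: "t \<in> I" "len I (w \<otimes> r t) < len I w"
      using descent_exists I less.prems False by metis
    have t\<Delta>: "t \<in> \<Delta>" and st: "s \<noteq> t" using t I less.prems by auto
    define p where "p k = word (alt s t k)" for k
    define x where "x k = (if even k then t else s)" for k :: nat
    define v where "v k = w \<otimes> inv (p k)" for k
    have alI: "alt s t k \<in> lists I" for k using alt_in_lists less.prems t by metis
    have al: "alt s t k \<in> lists \<Delta>" for k using alt_in_lists s t\<Delta> by metis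
    have pc: "p k \<in> carrier W" for k using al by (simp add: p_def)
    have xI: "x k \<in> I" "x k \<in> \<Delta>" for k using t less.prems t\<Delta> s by (auto simp: x_def)
    have pI: "p k \<in> generate W (r ` I)" for k using alI by (auto simp: p_def generate_eq_words[OF I])
    have vI: "v k \<in> generate W (r ` I)" for k
      using less.prems pI sub by (simp add: v_def subgroup.m_closed subgroup.m_inv_closed)
    have vc: "v k \<in> carrier W" for k using standard_carrier[OF I vI] .
    have w_eq: "w = v k \<otimes> p k" for k using wc pc by (simp add: v_def m_assoc)
    have v_Suc: "v (Suc k) = v k \<otimes> r (x k)" for k
      using wc pc xI by (simp add: v_def p_def x_def inv_mult_group r_self_inverse m_assoc)
    have v_back: "v (Suc k) \<otimes> r (x k) = v k" for k using v_Suc vc xI r_cancel by metis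
    have lenw: "len I w \<le> len I (v k) + k" for k
      using len_mult_word[OF I vI alI, of k k] w_eq[of k] by (simp add: p_def)
    \<comment> \<open>The lengths k for which splitting off the alternating suffix p k is reduced.\<close>
    define S where "S = {k. len I (v k) + k = len I w}"
    have fin: "finite S" by (rule finite_subset[of _ "{..len I w}"]) (auto simp: S_def)
    have "v 1 = w \<otimes> r t" using wc t\<Delta> by (simp add: v_def p_def r_self_inverse)
    hence "1 \<in> S" using t lenw[of 1] by (simp add: S_def)
    define K where "K = Max S"
    have KS: "K \<in> S" using fin \<open>1 \<in> S\<close> by (auto simp: K_def intro: Max_in)
    have K1: "K \<ge> 1" using fin \<open>1 \<in> S\<close> by (simp add: K_def)
    then obtain j where j: "K = Suc j" by (cases K) auto
    have lenK: "len I (v K) + K = len I w" using KS by (simp add: S_def)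
    have "Suc K \<notin> S" using Max_ge[OF fin, of "Suc K"] by (auto simp flip: K_def)
    hence up1: "\<not> len I (v K \<otimes> r (x K)) < len I (v K)"
      using lenw[of "Suc K"] lenK by (simp add: S_def v_Suc)
    have up2: "\<not> len I (v K \<otimes> r (x j)) < len I (v K)"
      using lenw[of j] lenK by (simp add: j v_back)
    have "len I (v K) < len I w" using lenK K1 by simp
    hence pos: "nonneg (rho (v K) (simple_root (x K)))" "nonneg (rho (v K) (simple_root (x j)))"
      using less.hyps[OF _ vI xI(1)] up1 up2 by blast+
    have K_lt: "K < n" if n: "m s t = enat n" for n
    proof (rule ccontr)
      assume "\<not> K < n"
      then obtain xs where xs: "xs \<in> lists {s, t}" "length xs < K" "word xs = word (alt s t K @ [s])"
        using alt_shorten[OF s t\<Delta> n, of K] m_ge_2[OF s t\<Delta> st n] by auto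
      have "word (alt s t K @ [s]) = p K \<otimes> r s" using al s by (simp add: word_append p_def)
      hence "w \<otimes> r s = v K \<otimes> word xs"
        using xs w_eq[of K] vc pc s by (simp add: m_assoc)
      moreover have "xs \<in> lists I" using xs t less.prems by auto
      ultimately have "len I (w \<otimes> r s) \<le> len I (v K) + length xs"
        using len_mult_word[OF I vI] by metis
      thus False using less.prems(3) lenK xs by simp
    qed
    have c: "cheb (cosine s t) K \<ge> 0" "cheb (cosine s t) (Suc K) \<ge> 0"
      using K_lt by (auto intro!: cheb_cosine_nonneg s t\<Delta> st simp: Suc_le_eq less_imp_le)
    have "rho w (simple_root s) = rho (v K) (rho (p K) (simple_root s))"
      using w_eq[of K] vc pc by (metis rho_mult)
    also have "\<dots> = lincomb (cheb (cosine s t) K) (rho (v K) (simple_root (x K)))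
        (cheb (cosine s t) (Suc K)) (rho (v K) (simple_root (x j)))"
      using alt_simple_root[OF s t\<Delta>, of K] vc
      by (simp add: p_def x_def j rho_lincomb del: cheb.simps alt.simps)
    finally show ?thesis using pos c by (simp add: nonneg_def lincomb_def)
  qed
qed

section \<open>Root systems of standard subgroups\<close>

lemma nonpos_if_descent:
  assumes "I \<subseteq> \<Delta>" "w \<in> generate W (r ` I)" "s \<in> I" "len I (w \<otimes> r s) < len I w"
  shows "nonneg (\<lambda>x. - rho w (simple_root s) x)"
proof -
  have s: "s \<in> \<Delta>" and w: "w \<in> carrier W" using assms standard_carrier by auto
  have ws: "w \<otimes> r s \<in> generate W (r ` I)"
    using assms standard_generator by (auto intro: generate.eng)
  have "nonneg (rho (w \<otimes> r s) (simple_root s))"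
    using assms ws r_cancel[OF s w] by (intro nonneg_if_not_descent[OF assms(1)]) auto
  moreover have "rho (w \<otimes> r s) (simple_root s) = (\<lambda>x. - rho w (simple_root s) x)"
    using s w by (simp add: rho_mult rho_generator reflection_simple_root_self rho_uminus)
  ultimately show ?thesis by simp
qed

definition roots :: "'a set \<Rightarrow> ('a \<Rightarrow> real) set" where
  "roots I = {rho w (simple_root s) | w s. w \<in> generate W (r ` I) \<and> s \<in> I}"

definition pos_roots :: "'a set \<Rightarrow> ('a \<Rightarrow> real) set" where
  "pos_roots I = {\<beta> \<in> roots I. nonneg \<beta>}"

lemma rho_simple_in_roots:
  "w \<in> generate W (r ` I) \<Longrightarrow> s \<in> I \<Longrightarrow> rho w (simple_root s) \<in> roots I"
  unfolding roots_def by blast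

lemma simple_in_roots: "s \<in> I \<Longrightarrow> simple_root s \<in> roots I"
  unfolding roots_def using generate.one[of W "r ` I"] by (force intro: exI[of _ "\<one>"])

lemma simple_in_pos_roots: "s \<in> I \<Longrightarrow> simple_root s \<in> pos_roots I"
  by (simp add: pos_roots_def simple_in_roots) (simp add: nonneg_def simple_root_def)

lemma roots_mono: "I \<subseteq> J \<Longrightarrow> roots I \<subseteq> roots J"
  unfolding roots_def using mono_generate[of "r ` I" "r ` J"] by blast

lemma rho_roots:
  assumes "I \<subseteq> \<Delta>" "w \<in> generate W (r ` I)" "\<beta> \<in> roots I"
  shows "rho w \<beta> \<in> roots I"
proof -
  obtain v s where v: "v \<in> generate W (r ` I)" "s \<in> I" "\<beta> = rho v (simple_root s)"
    using assms by (auto simp: roots_def)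
  hence "rho w \<beta> = rho (w \<otimes> v) (simple_root s)"
    using assms standard_carrier rho_mult by metis
  moreover have "w \<otimes> v \<in> generate W (r ` I)" using assms v by (auto intro: generate.eng)
  ultimately show ?thesis using v by (auto simp: roots_def)
qed

lemma uminus_roots:
  assumes "I \<subseteq> \<Delta>" "\<beta> \<in> roots I" shows "(\<lambda>x. - \<beta> x) \<in> roots I"
proof -
  obtain v s where v: "v \<in> generate W (r ` I)" "s \<in> I" "\<beta> = rho v (simple_root s)"
    using assms by (auto simp: roots_def)
  have s: "s \<in> \<Delta>" and vc: "v \<in> carrier W" using v assms standard_carrier by auto
  have "rho v (rho (r s) (simple_root s)) = (\<lambda>x. - \<beta> x)"
    using v s vc by (simp add: rho_generator reflection_simple_root_self rho_uminus)
  moreover have "rho v (rho (r s) (simple_root s)) \<in> roots I"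
    using assms v simple_in_roots standard_generator by (metis rho_roots)
  ultimately show ?thesis by simp
qed

lemma root_nonneg_or_nonpos:
  assumes "I \<subseteq> \<Delta>" "\<beta> \<in> roots I" shows "nonneg \<beta> \<or> nonneg (\<lambda>x. - \<beta> x)"
  using assms nonneg_if_not_descent nonpos_if_descent unfolding roots_def by blast

lemma qform_root:
  assumes "I \<subseteq> \<Delta>" "\<beta> \<in> roots I" shows "qform \<beta> = 1"
proof -
  obtain v s where v: "v \<in> generate W (r ` I)" "s \<in> I" "\<beta> = rho v (simple_root s)"
    using assms by (auto simp: roots_def)
  have s: "s \<in> \<Delta>" and vc: "v \<in> carrier W" using v assms standard_carrier by auto
  have "qform (simple_root s) = (\<Sum>a\<in>\<Delta>. if a = s then coroot s (simple_root s) else 0)"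
    unfolding qform_def by (intro sum.cong) (auto simp: simple_root_def)
  hence "qform (simple_root s) = 1"
    using s finite_rank by (simp add: coroot_simple_root cosine_diag)
  thus ?thesis using v vc by (simp add: qform_rho)
qed

lemma root_nonzero:
  assumes "I \<subseteq> \<Delta>" "\<beta> \<in> roots I" shows "\<exists>x. \<beta> x \<noteq> 0"
proof (rule ccontr)
  assume "\<not> ?thesis"
  hence "qform \<beta> = 0" by (simp add: qform_def)
  thus False using qform_root[OF assms] by simp
qed

lemma root_not_both_signs:
  assumes "I \<subseteq> \<Delta>" "\<beta> \<in> roots I" "nonneg \<beta>" shows "\<not> nonneg (\<lambda>x. - \<beta> x)"
  using assms root_nonzero[OF assms(1,2)] unfolding nonneg_def
  by (metis neg_0_le_iff_le order_antisym)

lemma reflection_outside: "x \<noteq> a \<Longrightarrow> reflection a v x = v x"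
  by (simp add: reflection_def lincomb_def simple_root_def)

lemma root_support:
  assumes "I \<subseteq> \<Delta>" "\<beta> \<in> roots I" "x \<notin> I" shows "\<beta> x = 0"
proof -
  obtain v s where v: "v \<in> generate W (r ` I)" "s \<in> I" "\<beta> = rho v (simple_root s)"
    using assms by (auto simp: roots_def)
  then obtain xs where xs: "xs \<in> lists I" "v = word xs" using assms generate_eq_words by auto
  have "xs \<in> lists I \<Longrightarrow> rho (word xs) u x = u x" for u
  proof (induction xs)
    case (Cons a xs)
    hence "a \<in> \<Delta>" "xs \<in> lists \<Delta>" "a \<noteq> x" using assms by auto
    thus ?case using Cons by (simp add: rho_mult rho_generator reflection_outside)
  qed simp
  thus ?thesis using v xs assms by (auto simp: simple_root_def)
qed

text \<open>
  A reflection changes a single coordinate. If it turned a positive root negative, all other coordinates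
  would vanish and the root would be a multiple of the simple root, hence equal to it by its norm.
\<close>
lemma reflection_pos_root:
  assumes I: "I \<subseteq> \<Delta>" "s \<in> I" and \<beta>: "\<beta> \<in> pos_roots I" "\<beta> \<noteq> simple_root s"
  shows "reflection s \<beta> \<in> pos_roots I"
proof -
  have s: "s \<in> \<Delta>" using I by auto
  have root: "\<beta> \<in> roots I" "nonneg \<beta>" using \<beta> by (auto simp: pos_roots_def)
  have r: "reflection s \<beta> \<in> roots I"
    using rho_roots[OF I(1) standard_generator[OF I(2)] root(1)] s by (simp add: rho_generator)
  have "nonneg (reflection s \<beta>)"
  proof (rule ccontr)
    assume "\<not> nonneg (reflection s \<beta>)"
    hence neg: "nonneg (\<lambda>x. - reflection s \<beta> x)" using root_nonneg_or_nonpos I r by auto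
    have "\<beta> x = 0" if "x \<noteq> s" for x
      using neg root(2) reflection_outside[OF that, of \<beta>] unfolding nonneg_def
      by (metis neg_0_le_iff_le order_antisym)
    hence eq: "\<beta> = lincomb (\<beta> s) (simple_root s) 0 (simple_root s)"
      by (auto simp: lincomb_def simple_root_def)
    have "coroot s \<beta> = \<beta> s"
      by (subst eq) (use s in \<open>simp add: coroot_lincomb coroot_simple_root cosine_diag\<close>)
    moreover have "qform \<beta> = (\<Sum>a\<in>\<Delta>. if a = s then \<beta> s * coroot s \<beta> else 0)"
      unfolding qform_def using \<open>\<And>x. x \<noteq> s \<Longrightarrow> \<beta> x = 0\<close> by (intro sum.cong) auto
    ultimately have "\<beta> s * \<beta> s = 1"
      using qform_root[OF I(1) root(1)] finite_rank s by simp
    moreover have "\<beta> s \<ge> 0" using root(2) by (simp add: nonneg_def)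
    ultimately have "\<beta> s = 1"
      by (metis abs_of_nonneg real_sqrt_abs2 real_sqrt_one)
    thus False using eq \<beta>(2) by (simp add: lincomb_def)
  qed
  thus ?thesis using r by (simp add: pos_roots_def)
qed

section \<open>Dominant forms and their stabilizers\<close>

text \<open>
  Linear forms on the representation space play the role of points of the dual space, on which the
  Tits cone lives. The form transported by inv g is the composition with the action of g.
\<close>
definition stab :: "(('a \<Rightarrow> real) \<Rightarrow> real) \<Rightarrow> 'g set" where
  "stab \<mu> = {g \<in> carrier W. \<forall>v. \<mu> (rho g v) = \<mu> v}"

lemma stab_subgroup: "subgroup (stab \<mu>) W"
proof (rule subgroupI)
  show "stab \<mu> \<noteq> {}" by (auto simp: stab_def intro: exI[of _ \<one>])
  show "inv g \<in> stab \<mu>" if "g \<in> stab \<mu>" for g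
    using that unfolding stab_def by simp (metis rho_inv(2))
qed (auto simp: stab_def rho_mult)

lemma linear_form_rho: "linear_form \<mu> \<Longrightarrow> g \<in> carrier W \<Longrightarrow> linear_form (\<mu> \<circ> rho g)"
  by (simp add: linear_form_def rho_lincomb)

lemma stab_rho:
  assumes "g \<in> carrier W" "h \<in> carrier W"
  shows "h \<in> stab (\<mu> \<circ> rho g) \<longleftrightarrow> g \<otimes> h \<otimes> inv g \<in> stab \<mu>"
proof
  assume "h \<in> stab (\<mu> \<circ> rho g)"
  hence "\<mu> (rho g (rho h (rho (inv g) v))) = \<mu> (rho g (rho (inv g) v))" for v
    by (simp add: stab_def)
  thus "g \<otimes> h \<otimes> inv g \<in> stab \<mu>" using assms by (simp add: stab_def rho_mult)
next
  assume "g \<otimes> h \<otimes> inv g \<in> stab \<mu>"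
  hence "\<mu> (rho g (rho h (rho (inv g) (rho g v)))) = \<mu> (rho g v)" for v
    using assms by (simp add: stab_def rho_mult del: rho_inv)
  thus "h \<in> stab (\<mu> \<circ> rho g)" using assms by (simp add: stab_def)
qed

definition dominant :: "'a set \<Rightarrow> (('a \<Rightarrow> real) \<Rightarrow> real) \<Rightarrow> bool" where
  "dominant I \<mu> \<longleftrightarrow> linear_form \<mu> \<and> (\<forall>s\<in>I. \<mu> (simple_root s) \<ge> 0)"

lemma dominant_pos_root:
  assumes "I \<subseteq> \<Delta>" "dominant I \<mu>" "\<beta> \<in> pos_roots I"
  shows "\<mu> \<beta> \<ge> 0"
proof -
  have "\<mu> \<beta> = (\<Sum>b\<in>I. \<beta> b * \<mu> (simple_root b))"
    using assms root_support finite_subset[OF assms(1) finite_rank]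
    by (intro linear_form_expand) (auto simp: dominant_def pos_roots_def)
  thus ?thesis using assms by (auto simp: dominant_def pos_roots_def nonneg_def intro!: sum_nonneg)
qed

text \<open>
  If w fixes the form and s is a descent of w, then w sends the simple root of s to a negative root, on which
  the form is at most 0; being fixed, it has the same value on the simple root, where it is at least 0.
  So this value is 0, the generator s fixes the form as well, and w can be shortened.
\<close>
theorem stab_dominant:
  assumes I: "I \<subseteq> \<Delta>" and \<mu>: "dominant I \<mu>"
  shows "generate W (r ` I) \<inter> stab \<mu> = generate W (r ` {s\<in>I. \<mu> (simple_root s) = 0})"
proof (intro equalityI subsetI)
  define K where "K = {s\<in>I. \<mu> (simple_root s) = 0}"
  have K: "K \<subseteq> I" "K \<subseteq> \<Delta>" using I by (auto simp: K_def)
  have lin: "\<mu> (lincomb p u q v) = p * \<mu> u + q * \<mu> v" for p u q v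
    using \<mu> by (simp add: dominant_def linear_form_def)
  {
    fix g assume "g \<in> generate W (r ` K)"
    moreover have "r ` K \<subseteq> generate W (r ` I) \<inter> stab \<mu>"
    proof safe
      fix s assume s: "s \<in> K"
      thus "r s \<in> generate W (r ` I)" using K standard_generator by auto
      have "\<mu> (reflection s v) = \<mu> v" for v using s by (simp add: reflection_def lin K_def)
      thus "r s \<in> stab \<mu>" using s K by (auto simp: stab_def rho_generator)
    qed
    ultimately show "g \<in> generate W (r ` I) \<inter> stab \<mu>"
      using generate_subgroup_incl subgroups_Inter_pair[OF standard_subgroup[OF I] stab_subgroup]
      by blast
  }
  {
    fix w assume "w \<in> generate W (r ` I) \<inter> stab \<mu>"
    thus "w \<in> generate W (r ` K)"
    proof (induction "len I w" arbitrary: w rule: less_induct)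
      case less
      show ?case
      proof (cases "w = \<one>")
        case True thus ?thesis by (simp add: generate.one)
      next
        case False
        then obtain s where s: "s \<in> I" "len I (w \<otimes> r s) < len I w"
          using descent_exists I less.prems by (metis IntD1)
        have w: "w \<in> generate W (r ` I)" "w \<in> stab \<mu>" "w \<in> carrier W" and s\<Delta>: "s \<in> \<Delta>"
          using less.prems s I standard_carrier by auto
        have "(\<lambda>x. - rho w (simple_root s) x) \<in> pos_roots I"
          unfolding pos_roots_def
          using nonpos_if_descent[OF I w(1) s] uminus_roots rho_roots simple_in_roots I s w by auto
        hence "- \<mu> (rho w (simple_root s)) \<ge> 0"
          using dominant_pos_root[OF I \<mu>] linear_form_uminus[of \<mu>] \<mu> by (metis dominant_def)
        moreover have "\<mu> (rho w (simple_root s)) = \<mu> (simple_root s)" using w by (simp add: stab_def)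
        moreover have "\<mu> (simple_root s) \<ge> 0" using \<mu> s by (simp add: dominant_def)
        ultimately have sK: "s \<in> K" using s by (simp add: K_def)
        have "r s \<in> stab \<mu>"
          using sK s\<Delta> by (simp add: stab_def rho_generator reflection_def lin K_def)
        hence "w \<otimes> r s \<in> stab \<mu>"
          using w stab_subgroup subgroup.m_closed by metis
        moreover have "w \<otimes> r s \<in> generate W (r ` I)"
          using w s standard_generator by (auto intro: generate.eng)
        ultimately have "w \<otimes> r s \<in> generate W (r ` K)" using less.hyps s by blast
        hence "w \<otimes> r s \<otimes> r s \<in> generate W (r ` K)"
          using sK standard_generator by (auto intro: generate.eng)
        thus ?thesis using w s\<Delta> r_cancel by simp
      qed
    qed
  }
qed

text \<open>
  Reflecting in a simple root on which the form is negative permutes the other positive roots, so it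
  removes one positive root with negative value. When there are finitely many of these, the process ends.
\<close>
theorem make_dominant:
  assumes I: "I \<subseteq> \<Delta>"
  shows "linear_form \<mu> \<Longrightarrow> finite {\<beta> \<in> pos_roots I. \<mu> \<beta> < 0} \<Longrightarrow>
    \<exists>w\<in>generate W (r ` I). dominant I (\<mu> \<circ> rho w)"
proof (induction "card {\<beta> \<in> pos_roots I. \<mu> \<beta> < 0}" arbitrary: \<mu> rule: less_induct)
  case less
  show ?case
  proof (cases "dominant I \<mu>")
    case True
    thus ?thesis by (intro bexI[of _ \<one>]) (auto intro: generate.one)
  next
    case False
    then obtain s where s: "s \<in> I" "\<mu> (simple_root s) < 0"
      using less.prems by (auto simp: dominant_def not_le)
    have s\<Delta>: "s \<in> \<Delta>" using s I by auto
    define N where "N \<mu> = {\<beta> \<in> pos_roots I. \<mu> \<beta> < 0}" for \<mu> :: "('a \<Rightarrow> real) \<Rightarrow> real"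
    define \<nu> where "\<nu> = \<mu> \<circ> rho (r s)"
    have \<nu>: "\<nu> v = \<mu> (reflection s v)" for v using s\<Delta> by (simp add: \<nu>_def rho_generator)
    have lin: "linear_form \<nu>" using less.prems s\<Delta> by (simp add: \<nu>_def linear_form_rho)
    have fin: "finite (N \<mu>)" using less.prems by (simp add: N_def)
    have sub: "reflection s ` N \<nu> \<subseteq> N \<mu> - {simple_root s}"
    proof safe
      fix \<beta> assume \<beta>: "\<beta> \<in> N \<nu>"
      have "\<nu> (simple_root s) > 0"
        using s s\<Delta> less.prems by (simp add: \<nu> reflection_simple_root_self linear_form_uminus)
      hence "\<beta> \<noteq> simple_root s" using \<beta> by (auto simp: N_def)
      thus "reflection s \<beta> \<in> N \<mu>" using \<beta> reflection_pos_root[OF I s(1)] by (simp add: N_def \<nu>)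
      assume "reflection s \<beta> = simple_root s"
      hence "\<beta> = reflection s (simple_root s)" using s\<Delta> reflection_reflection by metis
      hence "\<beta> = (\<lambda>x. - simple_root s x)" using s\<Delta> reflection_simple_root_self by simp
      hence "\<beta> s < 0" by (simp add: simple_root_def)
      thus False using \<beta> by (auto simp: N_def pos_roots_def nonneg_def not_le[symmetric])
    qed
    have inj: "inj_on (reflection s) A" for A using s\<Delta> reflection_reflection by (metis inj_on_inverseI)
    have finN: "finite (N \<nu>)" using sub fin inj finite_imageD finite_subset
      by (metis finite_Diff)
    have "card (N \<nu>) = card (reflection s ` N \<nu>)" using inj card_image by metis
    also have "\<dots> \<le> card (N \<mu> - {simple_root s})" using sub fin by (intro card_mono) auto
    also have "\<dots> < card (N \<mu>)"
      using s fin simple_in_pos_roots[OF s(1)] by (intro card_Diff1_less) (auto simp: N_def)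
    finally obtain w where w: "w \<in> generate W (r ` I)" "dominant I (\<nu> \<circ> rho w)"
      using less.hyps[of \<nu>] lin finN unfolding N_def by auto
    have "\<nu> \<circ> rho w = \<mu> \<circ> rho (r s \<otimes> w)"
      using w s\<Delta> standard_carrier[OF I] by (auto simp: \<nu>_def rho_mult)
    moreover have "r s \<otimes> w \<in> generate W (r ` I)"
      using w s standard_generator by (auto intro: generate.eng)
    ultimately show ?thesis using w by metis
  qed
qed

text \<open>
  Prefixing one generator to a word adds at most one positive root that is made negative.
\<close>
lemma finite_inversions:
  assumes "g \<in> carrier W"
  shows "finite {\<beta> \<in> pos_roots \<Delta>. nonneg (\<lambda>x. - rho g \<beta> x)}" (is "finite (?N g)")
proof -
  obtain xs where xs: "xs \<in> lists \<Delta>" "g = word xs"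
    using assms generate_eq_words[of \<Delta>] by (auto simp: generate_all)
  have "xs \<in> lists \<Delta> \<Longrightarrow> finite (?N (word xs))"
  proof (induction xs)
    case Nil
    have "?N (word []) = {}" using root_not_both_signs[of \<Delta>] by (auto simp: pos_roots_def)
    thus ?case by (simp only: finite.emptyI)
  next
    case (Cons a xs)
    hence a: "a \<in> \<Delta>" and xs: "xs \<in> lists \<Delta>" by auto
    define g where "g = word xs"
    have g: "g \<in> carrier W" "g \<in> generate W (r ` \<Delta>)" using xs by (auto simp: g_def generate_all)
    have "?N (word (a # xs)) \<subseteq> ?N g \<union> {rho (inv g) (simple_root a)}"
    proof safe
      fix \<beta> assume \<beta>: "\<beta> \<in> pos_roots \<Delta>" "nonneg (\<lambda>x. - rho (word (a # xs)) \<beta> x)"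
        "\<beta> \<noteq> rho (inv g) (simple_root a)"
      have rr: "rho g \<beta> \<in> roots \<Delta>" using \<beta> g rho_roots by (auto simp: pos_roots_def)
      show "nonneg (\<lambda>x. - rho g \<beta> x)"
      proof (rule ccontr)
        assume "\<not> ?thesis"
        hence "rho g \<beta> \<in> pos_roots \<Delta>" using rr root_nonneg_or_nonpos by (auto simp: pos_roots_def)
        moreover have "rho g \<beta> \<noteq> simple_root a" using \<beta>(3) g by (metis rho_inv(1))
        ultimately have "reflection a (rho g \<beta>) \<in> pos_roots \<Delta>" using reflection_pos_root a by blast
        moreover have "rho (word (a # xs)) \<beta> = reflection a (rho g \<beta>)"
          using a g by (simp add: rho_mult rho_generator flip: g_def)
        ultimately show False using \<beta>(2) root_not_both_signs[of \<Delta>] by (auto simp: pos_roots_def)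
      qed
    qed
    moreover have "finite (?N g)" using Cons.IH xs by (simp add: g_def)
    ultimately show ?case using finite_subset by (metis (no_types, lifting) finite.simps finite_Un)
  qed
  thus ?thesis using xs by simp
qed

text \<open>
  An element is determined by the images of the simple roots: one that fixes them all has no descent.
\<close>
lemma standard_finite_if_roots_finite:
  assumes K: "K \<subseteq> \<Delta>" and fin: "finite (roots K)"
  shows "finite (generate W (r ` K))"
proof -
  define f where "f g = (\<lambda>s\<in>K. rho g (simple_root s))" for g
  have "inj_on f (generate W (r ` K))"
  proof (rule inj_onI)
    fix u w assume uw: "u \<in> generate W (r ` K)" "w \<in> generate W (r ` K)" "f u = f w"
    define g where "g = inv w \<otimes> u"
    have c: "u \<in> carrier W" "w \<in> carrier W" using uw K standard_carrier by auto
    have g: "g \<in> generate W (r ` K)" using uw standard_subgroup[OF K]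
      by (simp add: g_def subgroup.m_closed subgroup.m_inv_closed)
    have fixed: "rho g (simple_root s) = simple_root s" if "s \<in> K" for s
    proof -
      have "rho u (simple_root s) = rho w (simple_root s)"
        using fun_cong[OF uw(3), of s] that by (simp add: f_def)
      thus ?thesis using c by (simp add: g_def rho_mult)
    qed
    have "g = \<one>"
    proof (rule ccontr)
      assume "g \<noteq> \<one>"
      then obtain s where s: "s \<in> K" "len K (g \<otimes> r s) < len K g"
        using descent_exists[OF K g] by metis
      hence "nonneg (\<lambda>x. - simple_root s x)" using nonpos_if_descent[OF K g s] fixed by simp
      thus False by (auto simp: nonneg_def simple_root_def dest: spec[of _ s])
    qed
    thus "u = w" using c by (metis g_def inv_closed inv_equality inv_inv)
  qed
  moreover have "f ` generate W (r ` K) \<subseteq> K \<rightarrow>\<^sub>E roots K"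
    by (auto simp: f_def intro: rho_simple_in_roots)
  moreover have "finite (K \<rightarrow>\<^sub>E roots K)"
    using fin finite_subset[OF K finite_rank] by (intro finite_PiE) auto
  ultimately show ?thesis using finite_imageD finite_subset by metis
qed

end

section \<open>Conjugates of subgroups\<close>

context group begin

lemma inv_cancel_left [simp]:
  assumes "g \<in> carrier G" "x \<in> carrier G"
  shows "inv g \<otimes> (g \<otimes> x) = x" "g \<otimes> (inv g \<otimes> x) = x"
  using assms by (simp_all flip: m_assoc)

lemma mem_conjugate_iff:
  assumes "g \<in> carrier G" "H \<subseteq> carrier G"
  shows "x \<in> (\<lambda>x. g \<otimes> x \<otimes> inv g) ` H \<longleftrightarrow> x \<in> carrier G \<and> inv g \<otimes> x \<otimes> g \<in> H"
proof
  assume "x \<in> (\<lambda>x. g \<otimes> x \<otimes> inv g) ` H"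
  then obtain y where "y \<in> H" "x = g \<otimes> y \<otimes> inv g" by auto
  moreover from this have "y \<in> carrier G" using assms by auto
  ultimately show "x \<in> carrier G \<and> inv g \<otimes> x \<otimes> g \<in> H" using assms by (simp add: m_assoc)
next
  assume "x \<in> carrier G \<and> inv g \<otimes> x \<otimes> g \<in> H"
  thus "x \<in> (\<lambda>x. g \<otimes> x \<otimes> inv g) ` H"
    using assms by (intro image_eqI[of _ _ "inv g \<otimes> x \<otimes> g"]) (auto simp: m_assoc)
qed

lemma conjugate_subgroup:
  assumes "g \<in> carrier G" "subgroup H G"
  shows "subgroup ((\<lambda>x. g \<otimes> x \<otimes> inv g) ` H) G"
proof -
  have H: "H \<subseteq> carrier G" using assms subgroup.subset by auto
  note iff = mem_conjugate_iff[OF assms(1) H]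
  show ?thesis
  proof (rule subgroupI)
    show "(\<lambda>x. g \<otimes> x \<otimes> inv g) ` H \<subseteq> carrier G" using iff by blast
    show "(\<lambda>x. g \<otimes> x \<otimes> inv g) ` H \<noteq> {}" using assms subgroup.one_closed by blast
    fix x assume "x \<in> (\<lambda>x. g \<otimes> x \<otimes> inv g) ` H"
    hence x: "x \<in> carrier G" "inv g \<otimes> x \<otimes> g \<in> H" using iff by auto
    have "inv (inv g \<otimes> x \<otimes> g) = inv g \<otimes> inv x \<otimes> g"
      using x assms(1) by (simp add: inv_mult_group m_assoc)
    thus "inv x \<in> (\<lambda>x. g \<otimes> x \<otimes> inv g) ` H"
      unfolding iff using x assms subgroup.m_inv_closed by fastforce
    fix y assume "y \<in> (\<lambda>x. g \<otimes> x \<otimes> inv g) ` H"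
    hence y: "y \<in> carrier G" "inv g \<otimes> y \<otimes> g \<in> H" using iff by auto
    have "(inv g \<otimes> x \<otimes> g) \<otimes> (inv g \<otimes> y \<otimes> g) = inv g \<otimes> (x \<otimes> y) \<otimes> g"
      using x y assms(1) by (simp add: m_assoc)
    thus "x \<otimes> y \<in> (\<lambda>x. g \<otimes> x \<otimes> inv g) ` H"
      unfolding iff using x y assms subgroup.m_closed by fastforce
  qed
qed

lemma inj_on_conjugate:
  assumes "g \<in> carrier G" "H \<subseteq> carrier G" shows "inj_on (\<lambda>x. g \<otimes> x \<otimes> inv g) H"
  using assms by (intro inj_onI) (auto simp: subset_iff)

lemma involution_subgroup:
  assumes "x \<in> carrier G" "x \<otimes> x = \<one>" shows "subgroup {\<one>, x} G"
  using assms by (intro subgroupI) (auto simp: inv_equality)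

end

context finite_rank_coxeter_group begin

section \<open>Finite subgroups and parabolic subgroups\<close>

lemma parabolic_subgroup: "is_parabolic W \<Delta> r P \<Longrightarrow> subgroup P W"
  by (auto simp: is_parabolic_def intro!: conjugate_subgroup standard_subgroup)

definition sum_form :: "'a set \<Rightarrow> ('a \<Rightarrow> real) \<Rightarrow> real" where
  "sum_form J v = (\<Sum>b\<in>J. v b)"

lemma linear_sum_form: "linear_form (sum_form J)"
  by (simp add: linear_form_def sum_form_def lincomb_def sum.distrib sum_distrib_left)

lemma height_pos_root: "\<beta> \<in> pos_roots \<Delta> \<Longrightarrow> sum_form \<Delta> \<beta> > 0"
proof -
  assume \<beta>: "\<beta> \<in> pos_roots \<Delta>"
  then obtain x where x: "\<beta> x \<noteq> 0" using root_nonzero[of \<Delta>] by (auto simp: pos_roots_def)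
  moreover have "x \<in> \<Delta>" using x \<beta> root_support[of \<Delta>] by (auto simp: pos_roots_def)
  moreover have "\<beta> y \<ge> 0" for y using \<beta> by (auto simp: pos_roots_def nonneg_def)
  ultimately show ?thesis
    unfolding sum_form_def using finite_rank
    by (intro sum_pos2[of _ x]) (auto simp: order_less_le)
qed

text \<open>
  Average the height over F. The result is fixed by F, and it can be at most 0 on a positive root only if
  some element of F makes that root negative, which happens for finitely many roots. So it can be made
  dominant, and its stabilizer is parabolic. The stabilizer is finite, because its roots are among the
  finitely many roots on which the averaged form vanishes.
\<close>
theorem finite_subgroup_in_parabolic:
  assumes F: "subgroup F W" "finite F"
  shows "\<exists>P. is_parabolic W \<Delta> r P \<and> finite P \<and> F \<subseteq> P"
proof -
  have Fc: "f \<in> carrier W" if "f \<in> F" for f using F subgroup.mem_carrier that by metis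
  have all: "generate W (r ` \<Delta>) = carrier W" by (rule generate_all)
  \<comment> \<open>The average up to the factor card F.\<close>
  define \<mu> where "\<mu> v = (\<Sum>f\<in>F. sum_form \<Delta> (rho f v))" for v
  have lin: "linear_form \<mu>"
    unfolding linear_form_def \<mu>_def
    using Fc linear_sum_form[of \<Delta>, unfolded linear_form_def]
    by (simp add: rho_lincomb sum.distrib sum_distrib_left)
  have F_stab: "F \<subseteq> stab \<mu>"
  proof
    fix h assume h: "h \<in> F"
    have "\<mu> (rho h v) = \<mu> v" for v
    proof -
      have "\<mu> (rho h v) = (\<Sum>f\<in>F. sum_form \<Delta> (rho (f \<otimes> h) v))"
        unfolding \<mu>_def using Fc h by (intro sum.cong) (simp_all add: rho_mult)
      also have "\<dots> = \<mu> v"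
        unfolding \<mu>_def
      proof (rule sum.reindex_bij_witness[of _ "\<lambda>f. f \<otimes> inv h" "\<lambda>f. f \<otimes> h"])
      qed (use Fc h F in \<open>auto simp: m_assoc subgroup.m_closed subgroup.m_inv_closed\<close>)
      finally show ?thesis .
    qed
    thus "h \<in> stab \<mu>" using Fc h by (simp add: stab_def)
  qed
  define Z where "Z = {\<beta> \<in> pos_roots \<Delta>. \<mu> \<beta> \<le> 0}"
  have "Z \<subseteq> (\<Union>f\<in>F. {\<beta> \<in> pos_roots \<Delta>. nonneg (\<lambda>x. - rho f \<beta> x)})"
  proof (rule subsetI, rule ccontr)
    fix \<beta> assume \<beta>: "\<beta> \<in> Z" "\<beta> \<notin> (\<Union>f\<in>F. {\<beta> \<in> pos_roots \<Delta>. nonneg (\<lambda>x. - rho f \<beta> x)})"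
    hence pos: "\<beta> \<in> pos_roots \<Delta>" "\<mu> \<beta> \<le> 0" by (auto simp: Z_def)
    have "sum_form \<Delta> (rho f \<beta>) > 0" if "f \<in> F" for f
    proof -
      have rt: "rho f \<beta> \<in> roots \<Delta>"
        using pos that Fc rho_roots[of \<Delta> f \<beta>] by (auto simp: pos_roots_def all)
      hence "nonneg (rho f \<beta>)" using \<beta> pos that root_nonneg_or_nonpos[of \<Delta> "rho f \<beta>"] by auto
      thus ?thesis using rt height_pos_root by (simp add: pos_roots_def)
    qed
    moreover have "F \<noteq> {}" using F subgroup.one_closed by blast
    ultimately have "\<mu> \<beta> > 0" unfolding \<mu>_def using F by (intro sum_pos) auto
    thus False using pos by simp
  qed
  hence finZ: "finite Z"
    using F Fc finite_inversions by (auto intro!: finite_subset[of Z] finite_UN_I)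
  have "finite {\<beta> \<in> pos_roots \<Delta>. \<mu> \<beta> < 0}"
    by (rule finite_subset[OF _ finZ]) (auto simp: Z_def)
  then obtain w where w: "w \<in> carrier W" "dominant \<Delta> (\<mu> \<circ> rho w)"
    using make_dominant[of \<Delta> \<mu>] lin by (auto simp: all)
  define K where "K = {s\<in>\<Delta>. (\<mu> \<circ> rho w) (simple_root s) = 0}"
  have K: "K \<subseteq> \<Delta>" by (auto simp: K_def)
  have stab_eq: "stab (\<mu> \<circ> rho w) = generate W (r ` K)"
    using stab_dominant[OF subset_refl w(2)] by (auto simp: K_def all stab_def)
  have "rho w ` roots K \<subseteq> Z \<union> (\<lambda>v x. - v x) ` Z"
  proof
    fix \<gamma> assume "\<gamma> \<in> rho w ` roots K"
    then obtain v s where v: "v \<in> generate W (r ` K)" "s \<in> K" "\<gamma> = rho w (rho v (simple_root s))"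
      by (auto simp: roots_def)
    have "(\<mu> \<circ> rho w) (rho v (simple_root s)) = (\<mu> \<circ> rho w) (simple_root s)"
      using v(1) unfolding stab_eq[symmetric] by (simp add: stab_def)
    hence \<mu>0: "\<mu> \<gamma> = 0" using v by (simp add: K_def)
    have rt: "\<gamma> \<in> roots \<Delta>"
    proof -
      have "rho v (simple_root s) \<in> roots K" using v by (auto simp: roots_def)
      hence "rho v (simple_root s) \<in> roots \<Delta>" using roots_mono K by auto
      thus ?thesis using rho_roots[of \<Delta> w] w v by (simp add: all)
    qed
    show "\<gamma> \<in> Z \<union> (\<lambda>v x. - v x) ` Z"
    proof (cases "nonneg \<gamma>")
      case True thus ?thesis using rt \<mu>0 by (simp add: Z_def pos_roots_def)
    next
      case False
      hence "(\<lambda>x. - \<gamma> x) \<in> Z"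
        using rt \<mu>0 root_nonneg_or_nonpos[of \<Delta>] uminus_roots[of \<Delta>] linear_form_uminus[OF lin]
        by (auto simp: Z_def pos_roots_def)
      thus ?thesis by (intro UnI2 image_eqI[of _ _ "\<lambda>x. - \<gamma> x"]) auto
    qed
  qed
  hence "finite (rho w ` roots K)" using finZ finite_subset by blast
  moreover have "inj_on (rho w) (roots K)" using w by (intro inj_on_inverseI[of _ "rho (inv w)"]) simp
  ultimately have "finite (generate W (r ` K))"
    using standard_finite_if_roots_finite[OF K] finite_imageD by blast
  moreover have "F \<subseteq> (\<lambda>x. w \<otimes> x \<otimes> inv w) ` generate W (r ` K)"
  proof
    fix f assume f: "f \<in> F"
    have "w \<otimes> (inv w \<otimes> f \<otimes> w) \<otimes> inv w = f" using w Fc f by (simp add: m_assoc)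
    hence "inv w \<otimes> f \<otimes> w \<in> stab (\<mu> \<circ> rho w)"
      using w Fc f F_stab by (subst stab_rho) auto
    thus "f \<in> (\<lambda>x. w \<otimes> x \<otimes> inv w) ` generate W (r ` K)"
      using w Fc f standard_carrier[OF K] unfolding stab_eq by (subst mem_conjugate_iff) auto
  qed
  ultimately show ?thesis using w K by (auto simp: is_parabolic_def intro!: exI)
qed

text \<open>
  After conjugation P is a finite standard subgroup for some I, and Q is the stabilizer of a form. Only
  finitely many roots belong to I, so an element of P makes this form dominant for I; then the intersection
  is the stabilizer of a dominant form in a standard subgroup.
\<close>
theorem parabolic_inter:
  assumes P: "is_parabolic W \<Delta> r P" "finite P" and Q: "is_parabolic W \<Delta> r Q"
  shows "is_parabolic W \<Delta> r (P \<inter> Q)"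
proof -
  obtain g I where g: "g \<in> carrier W" "I \<subseteq> \<Delta>"
    and P_eq: "P = (\<lambda>x. g \<otimes> x \<otimes> inv g) ` generate W (r ` I)"
    using P by (auto simp: is_parabolic_def)
  obtain h J where h: "h \<in> carrier W" "J \<subseteq> \<Delta>"
    and Q_eq: "Q = (\<lambda>x. h \<otimes> x \<otimes> inv h) ` generate W (r ` J)"
    using Q by (auto simp: is_parabolic_def)
  have sub: "generate W (r ` I) \<subseteq> carrier W" "generate W (r ` J) \<subseteq> carrier W"
    using g h standard_carrier by auto
  have "finite (generate W (r ` I))"
    using P(2) inj_on_conjugate[OF g(1) sub(1)] finite_imageD unfolding P_eq by blast
  moreover have "roots I = (\<lambda>(w, s). rho w (simple_root s)) ` (generate W (r ` I) \<times> I)"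
    by (auto simp: roots_def)
  ultimately have fin: "finite (roots I)" using finite_subset[OF g(2) finite_rank] by simp
  \<comment> \<open>A dominant form whose zeros among the simple roots are those in J.\<close>
  define \<nu> where "\<nu> = sum_form (\<Delta> - J)"
  have fD: "finite (\<Delta> - J)" using finite_rank by simp
  have \<nu>_simple: "\<nu> (simple_root s) = (if s \<in> \<Delta> - J then 1 else 0)" for s
    using fD by (simp add: \<nu>_def sum_form_def simple_root_def)
  have "dominant \<Delta> \<nu>"
    by (auto simp: dominant_def \<nu>_simple) (simp add: \<nu>_def linear_sum_form)
  moreover have "{s\<in>\<Delta>. \<nu> (simple_root s) = 0} = J" using h(2) by (auto simp: \<nu>_simple)
  ultimately have stab_\<nu>: "stab \<nu> = generate W (r ` J)"
    using stab_dominant[of \<Delta> \<nu>] by (auto simp: generate_all stab_def)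
  define k where "k = inv g \<otimes> h"
  have k: "k \<in> carrier W" using g h by (simp add: k_def)
  define \<mu> where "\<mu> = \<nu> \<circ> rho (inv k)"
  have "linear_form \<mu>" using k by (simp add: \<mu>_def \<nu>_def linear_form_rho linear_sum_form)
  moreover have "finite {\<beta> \<in> pos_roots I. \<mu> \<beta> < 0}"
    by (rule finite_subset[OF _ fin]) (auto simp: pos_roots_def)
  ultimately obtain w where w: "w \<in> generate W (r ` I)" "dominant I (\<mu> \<circ> rho w)"
    using make_dominant[OF g(2)] by blast
  have wc: "w \<in> carrier W" using w sub by auto
  define K where "K = {s\<in>I. (\<mu> \<circ> rho w) (simple_root s) = 0}"
  have K: "K \<subseteq> \<Delta>" using g(2) by (auto simp: K_def)
  have W_K: "generate W (r ` I) \<inter> stab (\<mu> \<circ> rho w) = generate W (r ` K)"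
    unfolding K_def by (rule stab_dominant[OF g(2) w(2)])
  have "x \<in> P \<inter> Q \<longleftrightarrow> x \<in> (\<lambda>x. (g \<otimes> w) \<otimes> x \<otimes> inv (g \<otimes> w)) ` generate W (r ` K)" for x
  proof (cases "x \<in> carrier W")
    case False
    thus ?thesis using g h wc K standard_carrier sub unfolding P_eq
      by (auto simp: mem_conjugate_iff)
  next
    case True
    define z where "z = inv g \<otimes> x \<otimes> g"
    have z: "z \<in> carrier W" using g True by (simp add: z_def)
    have "inv (g \<otimes> w) \<otimes> x \<otimes> (g \<otimes> w) = inv w \<otimes> z \<otimes> w"
      using g wc True by (simp add: z_def inv_mult_group m_assoc)
    hence "x \<in> (\<lambda>x. (g \<otimes> w) \<otimes> x \<otimes> inv (g \<otimes> w)) ` generate W (r ` K)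
        \<longleftrightarrow> inv w \<otimes> z \<otimes> w \<in> generate W (r ` K)"
      using g wc True standard_carrier[OF K] by (subst mem_conjugate_iff) auto
    also have "\<dots> \<longleftrightarrow> inv w \<otimes> z \<otimes> w \<in> generate W (r ` I) \<and> inv w \<otimes> z \<otimes> w \<in> stab (\<mu> \<circ> rho w)"
      unfolding W_K[symmetric] by simp
    also have "inv w \<otimes> z \<otimes> w \<in> generate W (r ` I) \<longleftrightarrow> z \<in> generate W (r ` I)"
    proof
      note S = standard_subgroup[OF g(2)]
      show "inv w \<otimes> z \<otimes> w \<in> generate W (r ` I)" if "z \<in> generate W (r ` I)"
        using that w S by (simp add: subgroup.m_closed subgroup.m_inv_closed)
      assume "inv w \<otimes> z \<otimes> w \<in> generate W (r ` I)"
      hence "w \<otimes> (inv w \<otimes> z \<otimes> w) \<otimes> inv w \<in> generate W (r ` I)"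
        using w S by (simp add: subgroup.m_closed subgroup.m_inv_closed)
      thus "z \<in> generate W (r ` I)" using wc z by (simp add: m_assoc)
    qed
    also have "\<dots> \<longleftrightarrow> x \<in> P"
      unfolding P_eq z_def using g True sub by (subst mem_conjugate_iff) auto
    also have "inv w \<otimes> z \<otimes> w \<in> stab (\<mu> \<circ> rho w) \<longleftrightarrow> z \<in> stab \<mu>"
      using wc z by (subst stab_rho) (auto simp: m_assoc)
    also have "\<dots> \<longleftrightarrow> inv k \<otimes> z \<otimes> inv (inv k) \<in> stab \<nu>"
      unfolding \<mu>_def using k z by (intro stab_rho) auto
    also have "inv k \<otimes> z \<otimes> inv (inv k) = inv h \<otimes> x \<otimes> h"
      using g h True by (simp add: k_def z_def inv_mult_group m_assoc)
    also have "inv h \<otimes> x \<otimes> h \<in> stab \<nu> \<longleftrightarrow> x \<in> Q"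
      unfolding Q_eq stab_\<nu> using h True sub by (subst mem_conjugate_iff) auto
    finally show ?thesis by simp
  qed
  hence "P \<inter> Q = (\<lambda>x. (g \<otimes> w) \<otimes> x \<otimes> inv (g \<otimes> w)) ` generate W (r ` K)" by blast
  thus ?thesis using g wc K unfolding is_parabolic_def by (metis m_closed)
qed

text \<open>
  A finite parabolic subgroup of least order containing the intersection lies in every member, since
  intersecting it with a member gives another such subgroup.
\<close>
lemma parabolic_Inter:
  assumes "\<F> \<noteq> {}" and \<F>: "\<And>F. F \<in> \<F> \<Longrightarrow> is_parabolic W \<Delta> r F \<and> finite F"
  shows "is_parabolic W \<Delta> r (\<Inter>\<F>)"
proof -
  define good where "good Q \<longleftrightarrow> is_parabolic W \<Delta> r Q \<and> finite Q \<and> \<Inter>\<F> \<subseteq> Q" for Q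
  obtain F where "F \<in> \<F>" using assms by auto
  hence "good F" using \<F> by (auto simp: good_def)
  then obtain Q where Q: "good Q" "\<And>R. good R \<Longrightarrow> card Q \<le> card R"
    using ex_has_least_nat[of good F card] by auto
  have "Q \<subseteq> F" if "F \<in> \<F>" for F
  proof -
    have "good (Q \<inter> F)"
      using Q(1) \<F>[OF that] parabolic_inter that by (auto simp: good_def)
    hence "card Q \<le> card (Q \<inter> F)" using Q by auto
    hence "Q \<inter> F = Q" using Q(1) by (intro card_seteq) (auto simp: good_def)
    thus ?thesis by auto
  qed
  hence "\<Inter>\<F> = Q" using Q(1) by (auto simp: good_def)
  thus ?thesis using Q(1) by (simp add: good_def)
qed

lemma maximal_finite_parabolic:
  assumes "maximal_finite_subgroup W F" shows "is_parabolic W \<Delta> r F"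
  using assms finite_subgroup_in_parabolic[of F] parabolic_subgroup
  unfolding maximal_finite_subgroup_def by metis

text \<open>
  Finite rank bounds the orders of the finite subgroups: each lies in a conjugate of one of the finitely many
  standard subgroups.
\<close>
lemma finite_subgroup_in_maximal:
  assumes H: "subgroup H W" "finite H"
  shows "\<exists>F. maximal_finite_subgroup W F \<and> H \<subseteq> F"
proof -
  \<comment> \<open>Infinite standard subgroups contribute 0 to this sum, as infinite sets have cardinality 0.\<close>
  define N where "N = (\<Sum>I\<in>Pow \<Delta>. card (generate W (r ` I)))"
  have bound: "card F \<le> N" if F: "subgroup F W" "finite F" for F
  proof -
    obtain P where P: "is_parabolic W \<Delta> r P" "finite P" "F \<subseteq> P"
      using finite_subgroup_in_parabolic[OF F] by auto
    then obtain g I where g: "g \<in> carrier W" "I \<subseteq> \<Delta>"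
      and P_eq: "P = (\<lambda>x. g \<otimes> x \<otimes> inv g) ` generate W (r ` I)"
      by (auto simp: is_parabolic_def)
    have "inj_on (\<lambda>x. g \<otimes> x \<otimes> inv g) (generate W (r ` I))"
      using g standard_carrier by (intro inj_on_conjugate) auto
    hence "card P = card (generate W (r ` I))" unfolding P_eq by (rule card_image)
    also have "\<dots> \<le> N" unfolding N_def using g finite_rank by (intro member_le_sum) auto
    finally show ?thesis using card_mono[OF P(2,3)] by simp
  qed
  define good where "good F \<longleftrightarrow> subgroup F W \<and> finite F \<and> H \<subseteq> F" for F
  have "good H" using H by (simp add: good_def)
  moreover have "card F < Suc N" if "good F" for F using that bound by (auto simp: good_def less_Suc_eq_le)
  ultimately obtain F where F: "good F" "\<And>F'. good F' \<Longrightarrow> card F' \<le> card F"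
    using ex_has_greatest_nat[of good H card "Suc N"] by blast
  have "F' = F" if "subgroup F' W" "finite F'" "F \<subseteq> F'" for F'
    using that F by (intro card_seteq[symmetric]) (auto simp: good_def)
  thus ?thesis using F(1) by (auto simp: maximal_finite_subgroup_def good_def)
qed

lemma parabolic_order_two:
  assumes "is_parabolic W \<Delta> r {\<one>, y}" "y \<noteq> \<one>"
  shows "is_reflection W \<Delta> r y"
proof -
  obtain g I where g: "g \<in> carrier W" "I \<subseteq> \<Delta>"
    and eq: "{\<one>, y} = (\<lambda>x. g \<otimes> x \<otimes> inv g) ` generate W (r ` I)"
    using assms by (auto simp: is_parabolic_def)
  have "I \<noteq> {}"
  proof
    assume "I = {}"
    hence "{\<one>, y} = {\<one>}" using eq g generate_empty by simp
    thus False using assms by auto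
  qed
  then obtain b where b: "b \<in> I" "b \<in> \<Delta>" using g by auto
  have "g \<otimes> r b \<otimes> inv g \<noteq> \<one>"
  proof
    assume *: "g \<otimes> r b \<otimes> inv g = \<one>"
    have "r b = inv g \<otimes> (g \<otimes> r b \<otimes> inv g) \<otimes> g" using g b by (simp add: m_assoc)
    also have "\<dots> = \<one>" unfolding * using g by simp
    finally show False using r_ne_one b by simp
  qed
  moreover have "g \<otimes> r b \<otimes> inv g \<in> {\<one>, y}" unfolding eq using b standard_generator by blast
  ultimately have "y = g \<otimes> r b \<otimes> inv g" by auto
  thus ?thesis using g b by (auto simp: is_reflection_def)
qed

section \<open>Finite continuations of involutions\<close>

definition finite_continuation :: "'g \<Rightarrow> 'g set" where
  "finite_continuation x = \<Inter> {F. maximal_finite_subgroup W F \<and> x \<in> F}"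

lemma finite_continuation_involution:
  assumes x: "x \<in> carrier W" "x \<otimes> x = \<one>"
  shows "is_parabolic W \<Delta> r (finite_continuation x)" "finite (finite_continuation x)"
    "{\<one>, x} \<subseteq> finite_continuation x"
proof -
  obtain F where F: "maximal_finite_subgroup W F" "{\<one>, x} \<subseteq> F"
    using finite_subgroup_in_maximal[OF involution_subgroup[OF x]] by auto
  show "is_parabolic W \<Delta> r (finite_continuation x)"
    unfolding finite_continuation_def using F maximal_finite_parabolic
    by (intro parabolic_Inter) (auto simp: maximal_finite_subgroup_def)
  show "finite (finite_continuation x)"
    unfolding finite_continuation_def using F
    by (intro finite_Inter) (auto simp: maximal_finite_subgroup_def)
  show "{\<one>, x} \<subseteq> finite_continuation x"
    by (auto simp: finite_continuation_def maximal_finite_subgroup_def subgroup.one_closed)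
qed

end

lemma iso_maximal_finite_subgroup:
  assumes G: "group G" "group H" and \<alpha>: "\<alpha> \<in> iso G H" and F: "maximal_finite_subgroup G F"
  shows "maximal_finite_subgroup H (\<alpha> ` F)"
proof -
  interpret group_hom G H \<alpha> using G \<alpha> by (simp add: group_hom_def group_hom_axioms_def iso_def)
  have bij: "bij_betw \<alpha> (carrier G) (carrier H)" using \<alpha> by (simp add: iso_def)
  have F': "subgroup F G" "finite F" using F by (auto simp: maximal_finite_subgroup_def)
  show ?thesis
    unfolding maximal_finite_subgroup_def
  proof (intro conjI allI impI)
    show "subgroup (\<alpha> ` F) H" using F'(1) by (rule subgroup_img_is_subgroup)
    show "finite (\<alpha> ` F)" using F' by simp
    fix K assume K: "subgroup K H \<and> finite K \<and> \<alpha> ` F \<subseteq> K"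
    define L where "L = {x \<in> carrier G. \<alpha> x \<in> K}"
    have KH: "K \<subseteq> carrier H" using K subgroup.subset by auto
    have "subgroup L G"
      unfolding L_def using K
      by (intro G.subgroupI)
        (auto simp: subgroup.m_closed subgroup.m_inv_closed subgroup.one_closed intro: exI[of _ "\<one>\<^bsub>G\<^esub>"])
    moreover have "finite L"
    proof (rule finite_imageD)
      show "finite (\<alpha> ` L)" using K by (auto simp: L_def intro: finite_subset[of _ K])
      show "inj_on \<alpha> L" using bij by (auto simp: L_def bij_betw_def intro: inj_on_subset)
    qed
    moreover have "F \<subseteq> L" using K F' subgroup.subset[of F G] by (auto simp: L_def)
    ultimately have "L = F" using F by (auto simp: maximal_finite_subgroup_def)
    moreover have "K \<subseteq> \<alpha> ` L"
      using KH bij by (auto simp: L_def bij_betw_def)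
    ultimately show "K = \<alpha> ` F" using K by auto
  qed
qed

theorem proposition23:
  fixes W :: "('g, 'x) monoid_scheme" and W' :: "('h, 'y) monoid_scheme"
    and \<Delta> :: "'a set" and \<Delta>' :: "'b set"
    and m :: "'a \<Rightarrow> 'a \<Rightarrow> enat" and m' :: "'b \<Rightarrow> 'b \<Rightarrow> enat"
    and r :: "'a \<Rightarrow> 'g" and r' :: "'b \<Rightarrow> 'h"
    and \<alpha> :: "'g \<Rightarrow> 'h" and a :: 'a
  assumes "coxeter_group W \<Delta> m r" and "finite \<Delta>"
    and "coxeter_group W' \<Delta>' m' r'" and "finite \<Delta>'"
    and "\<alpha> \<in> iso W W'"
    and "a \<in> \<Delta>"
    and "\<not> is_reflection W' \<Delta>' r' (\<alpha> (r a))"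
  shows "is_parabolic W \<Delta> r (\<Inter> {F. maximal_finite_subgroup W F \<and> r a \<in> F})
    \<and> card (\<Inter> {F. maximal_finite_subgroup W F \<and> r a \<in> F}) > 2"
proof -
  interpret W: finite_rank_coxeter_group W \<Delta> m r
    using assms by (intro finite_rank_coxeter_group.intro finite_rank_coxeter_group_axioms.intro)
  interpret W': finite_rank_coxeter_group W' \<Delta>' m' r'
    using assms by (intro finite_rank_coxeter_group.intro finite_rank_coxeter_group_axioms.intro)
  interpret \<alpha>: group_hom W W' \<alpha>
    using assms(5) by unfold_locales (simp add: iso_def)
  have inj: "inj_on \<alpha> (carrier W)" and surj: "\<alpha> ` carrier W = carrier W'"
    using assms(5) by (auto simp: iso_def bij_betw_def)
  have ra: "r a \<in> carrier W" "r a \<otimes>\<^bsub>W\<^esub> r a = \<one>\<^bsub>W\<^esub>" "r a \<noteq> \<one>\<^bsub>W\<^esub>"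
    using assms(6) W.r_ne_one by auto
  let ?C = "W.finite_continuation (r a)" and ?C' = "W'.finite_continuation (\<alpha> (r a))"
  note C = W.finite_continuation_involution[OF ra(1,2)]
  have "\<alpha> (r a) \<otimes>\<^bsub>W'\<^esub> \<alpha> (r a) = \<one>\<^bsub>W'\<^esub>" using ra by (metis \<alpha>.hom_mult \<alpha>.hom_one)
  note C' = W'.finite_continuation_involution[OF \<alpha>.hom_closed[OF ra(1)] this]
  have "card ?C \<noteq> 2"
  proof
    assume "card ?C = 2"
    hence C_eq: "?C = {\<one>\<^bsub>W\<^esub>, r a}"
      using C ra by (intro card_seteq[symmetric]) auto
    have "?C' \<subseteq> {\<one>\<^bsub>W'\<^esub>, \<alpha> (r a)}"
    proof
      fix y assume y: "y \<in> ?C'"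
      hence "y \<in> carrier W'" using C'(1) W'.parabolic_subgroup subgroup.mem_carrier by metis
      then obtain x where x: "x \<in> carrier W" "y = \<alpha> x" using surj by auto
      have "x \<in> F" if F: "maximal_finite_subgroup W F" "r a \<in> F" for F
      proof -
        have "maximal_finite_subgroup W' (\<alpha> ` F)"
          using iso_maximal_finite_subgroup[OF _ _ assms(5) F(1)] W.is_group W'.is_group by simp
        hence "y \<in> \<alpha> ` F" using y F by (auto simp: W'.finite_continuation_def)
        moreover have "F \<subseteq> carrier W"
          using F subgroup.subset by (auto simp: maximal_finite_subgroup_def)
        ultimately show ?thesis using x inj by (auto simp: inj_on_def)
      qed
      hence "x \<in> ?C" by (auto simp: W.finite_continuation_def)
      thus "y \<in> {\<one>\<^bsub>W'\<^esub>, \<alpha> (r a)}" using C_eq x by auto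
    qed
    hence "?C' = {\<one>\<^bsub>W'\<^esub>, \<alpha> (r a)}" using C'(3) by blast
    moreover have "\<alpha> (r a) \<noteq> \<one>\<^bsub>W'\<^esub>"
      using ra inj by (metis \<alpha>.hom_one inj_onD W.one_closed)
    ultimately show False using C'(1) W'.parabolic_order_two assms(7) by simp
  qed
  moreover have "card ?C \<ge> 2" using card_mono[OF C(2,3)] ra(3) by simp
  ultimately show ?thesis using C(1) by (simp add: W.finite_continuation_def)
qed

end
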